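(* Let $d=1$, and let $p\in(1,\infty)$ and $m>0$ satisfy $m(p-1)>1$ and $p>2$. Let $x,o\in\mathbb{R}$, let $X$ be a probabilistically weak solution (as defined in the context) starting at $x$, on a stochastic basis $(\Omega,\mathscr{F},\mathscr{F}_\bullet,\mathbf{P}^x)$, and let $L^o$ be the local time of $X$ at $o$. Then for every $t\in[0,\infty)$, $$\mathbf{E}^x[L_t^o]=\begin{cases}\displaystyle 2m^{p-1}\int_{[0,t]}|\nabla w^x(s,o)|^{p-2}\,w^x(s,o)^{(m-1)(p-1)+1}\,\mathrm{d}s&\text{if }x\neq o,\\[2mm]0&\text{if }x=o,\end{cases}$$ where the integrand is understood to be $0$ for those $s$ with $|o-x|\ge\rho s^{1/\beta}$.
   Context: Here $d=1$, and the condition $p>2$ is the condition $dp>d+1$ for $d=1$. Parameters: $\beta:=p+m(p-1)-1$, $\gamma:=\frac{p-1}{m(p-1)-1}$, $\kappa:=\frac{m(p-1)-1}{mp}\beta^{-1/(p-1)}$, all positive. Barenblatt profile: for $t>0$, $r\ge 0$, $S(t,r):=C-\kappa[t^{-1/\beta}r]^{p/(p-1)}$ and $U(t,r):=t^{-1/\beta}\,\max\{S(t,r),0\}^\gamma$, where $C>0$ is the unique constant (depending only on $p,m$) such that $2\int_0^\infty U(t,r)\,\mathrm{d}r=1$ for every $t>0$. Put $\rho:=(C/\kappa)^{(p-1)/p}$; the support of $U(t,\cdot)$ is $[0,\rho t^{1/\beta}]$. The Barenblatt solution is $w^x(t,y):=U(t,|y-x|)$, $x,y\in\mathbb{R}$;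 $\nabla$ is the derivative in $y$. Coefficients: for $0<r<\rho t^{1/\beta}$ let $a(t,r):=m^{p-1}|\partial_rU(t,r)|^{p-2}U(t,r)^{(m-1)(p-1)}$ and $a_r:=\partial_r a$; set $a(t,r):=a_r(t,r):=0$ for $r\ge\rho t^{1/\beta}$ and for $r=0$. For $z\in\mathbb{R}$, $\mathrm{sgn}\,z:=z/|z|$ if $z\ne0$, $\mathrm{sgn}\,0:=0$. A stochastic basis is a complete probability space $(\Omega,\mathscr{F},\mathbf{P}^x)$ with a right-continuous filtration $\mathscr{F}_\bullet$ augmented by null sets; $\mathbf{E}^x$ denotes expectation. A probabilistically weak solution starting at $x\in\mathbb{R}$ is a continuous $\mathscr{F}_\bullet$-adapted real process $X$ on a stochastic basis carrying a standard $\mathscr{F}_\bullet$-Brownian motion $W$ on $\mathbb{R}$ such that (a) $\mathbf{E}^x[\int_0^t a(s,|X_s-x|)\,\mathrm{d}s]<\infty$ and $\mathbf{E}^x[\int_0^t|a_r(s,|X_s-x|)|\,\mathrm{d}s]<\infty$ for every $t>0$; (b) $\mathbf{P}^x$-a.s., for all $t\ge0$, $X_t=X_0+\int_0^t\sqrt{2a(s,|X_s-x|)}\,\mathrm{d}W_s+\int_0^t a_r(s,|X_s-x|)\,\mathrm{sgn}(X_s-x)\,\mathrm{d}s$; (c) for every $t>0$ the law of $X_t$ is $w^x(t,\cdot)\,\mathscr{L}^1$; consequently $X_0=x$ a.s. Local time: $L^o$ is the local time at $o$ of the continuous semimartingale $X$, i.e. the nonnegative, nondecreasing, adapted process given by Tanaka's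 formula $|X_t-o|=|x-o|+\int_0^t\mathrm{sgn}(X_s-o)\,\mathrm{d}X_s+L_t^o$, taken in the modification for which $(t,o)\mapsto L_t^o$ is jointly continuous outside a $\mathbf{P}^x$-null set. *)

theory Defs
  imports "HOL-Probability.Probability"
begin

section \<open>Stochastic bases, Brownian motion and the Ito integral\<close>

text \<open>Time is the half-line of nonnegative reals: processes and filtrations are indexed by
  \<^typ>\<open>real\<close>, and only their values at indices \<open>t \<ge> 0\<close> are constrained or used.\<close>

locale stochastic_basis = prob_space M + complete_measure M
  for M :: "'a measure" +
  fixes F :: "real \<Rightarrow> 'a measure"
  assumes subalgebra_F: "\<And>t. 0 \<le> t \<Longrightarrow> subalgebra M (F t)"
    and F_mono: "\<And>s t. 0 \<le> s \<Longrightarrow> s \<le> t \<Longrightarrow> sets (F s) \<subseteq> sets (F t)"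
    and F_right_continuous: "\<And>t. 0 \<le> t \<Longrightarrow> (\<Inter>s\<in>{t<..}. sets (F s)) = sets (F t)"
    and F_null_sets: "null_sets M \<subseteq> sets (F 0)"

definition adapted :: "(real \<Rightarrow> 'a measure) \<Rightarrow> (real \<Rightarrow> 'a \<Rightarrow> real) \<Rightarrow> bool" where
  "adapted F X \<longleftrightarrow> (\<forall>t\<ge>0. X t \<in> borel_measurable (F t))"

definition continuous_process :: "'a measure \<Rightarrow> (real \<Rightarrow> 'a \<Rightarrow> real) \<Rightarrow> bool" where
  "continuous_process M X \<longleftrightarrow> (\<forall>\<omega>\<in>space M. continuous_on {0..} (\<lambda>t. X t \<omega>))"

definition progressive :: "(real \<Rightarrow> 'a measure) \<Rightarrow> (real \<Rightarrow> 'a \<Rightarrow> real) \<Rightarrow> bool" where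
  "progressive F H \<longleftrightarrow>
     (\<forall>t\<ge>0. (\<lambda>(s, \<omega>). H s \<omega>) \<in> borel_measurable (restrict_space borel {0..t} \<Otimes>\<^sub>M F t))"

definition brownian_motion ::
  "'a measure \<Rightarrow> (real \<Rightarrow> 'a measure) \<Rightarrow> (real \<Rightarrow> 'a \<Rightarrow> real) \<Rightarrow> bool" where
  "brownian_motion M F W \<longleftrightarrow>
     adapted F W \<and> continuous_process M W \<and> (AE \<omega> in M. W 0 \<omega> = 0) \<and>
     (\<forall>s t. 0 \<le> s \<and> s < t \<longrightarrow>
        distributed M lborel (\<lambda>\<omega>. W t \<omega> - W s \<omega>) (\<lambda>y. ennreal (normal_density 0 (sqrt (t - s)) y)) \<and>
        prob_space.indep_set M (sets (F s))
          (sets (vimage_algebra (space M) (\<lambda>\<omega>. W t \<omega> - W s \<omega>) borel)))"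

text \<open>The triple \<open>n, \<tau>, \<xi>\<close> encodes the simple process
  \<open>\<Sum>i<n. \<xi>\<^sub>i \<cdot> 1\<^bsub>(\<tau>\<^sub>i, \<tau>\<^sub>i\<^sub>+\<^sub>1]\<^esub>\<close>, with \<open>\<xi>\<^sub>i\<close> bounded and
  measurable at time \<open>\<tau>\<^sub>i\<close>.\<close>

definition simple_data ::
  "'a measure \<Rightarrow> (real \<Rightarrow> 'a measure) \<Rightarrow> nat \<Rightarrow> (nat \<Rightarrow> real) \<Rightarrow> (nat \<Rightarrow> 'a \<Rightarrow> real) \<Rightarrow> bool" where
  "simple_data M F n \<tau> \<xi> \<longleftrightarrow>
     0 \<le> \<tau> 0 \<and>
     (\<forall>i<n. \<tau> i \<le> \<tau> (Suc i) \<and> \<xi> i \<in> borel_measurable (F (\<tau> i)) \<and>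
        (\<exists>B. \<forall>\<omega>\<in>space M. \<bar>\<xi> i \<omega>\<bar> \<le> B))"

definition simple_process ::
  "nat \<Rightarrow> (nat \<Rightarrow> real) \<Rightarrow> (nat \<Rightarrow> 'a \<Rightarrow> real) \<Rightarrow> real \<Rightarrow> 'a \<Rightarrow> real" where
  "simple_process n \<tau> \<xi> s \<omega> = (\<Sum>i<n. \<xi> i \<omega> * indicator {\<tau> i<..\<tau> (Suc i)} s)"

definition simple_integral ::
  "nat \<Rightarrow> (nat \<Rightarrow> real) \<Rightarrow> (nat \<Rightarrow> 'a \<Rightarrow> real) \<Rightarrow> (real \<Rightarrow> 'a \<Rightarrow> real) \<Rightarrow> real \<Rightarrow> 'a \<Rightarrow> real" where
  "simple_integral n \<tau> \<xi> W t \<omega> =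
     (\<Sum>i<n. \<xi> i \<omega> * (W (min t (\<tau> (Suc i))) \<omega> - W (min t (\<tau> i)) \<omega>))"

text \<open>\<open>ito_integral M F W H I\<close>: the continuous process \<open>I\<close> is (a version of) the Ito integral
  \<open>t \<mapsto> \<integral>\<^sub>0\<^sup>t H\<^sub>s dW\<^sub>s\<close>. This is the \<open>L\<^sup>2\<close> construction, for progressive \<open>H\<close>
  with \<open>E \<integral>\<^sub>0\<^sup>t H\<^sub>s\<^sup>2 ds < \<infinity>\<close> for all \<open>t\<close>: the integral is the \<open>L\<^sup>2\<close>-limit of
  the integrals of approximating simple processes. By the Ito isometry it determines \<open>I\<close> up to
  indistinguishability and does not depend on the approximating sequence.\<close>

definition ito_integral ::
  "'a measure \<Rightarrow> (real \<Rightarrow> 'a measure) \<Rightarrow> (real \<Rightarrow> 'a \<Rightarrow> real) \<Rightarrow>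
   (real \<Rightarrow> 'a \<Rightarrow> real) \<Rightarrow> (real \<Rightarrow> 'a \<Rightarrow> real) \<Rightarrow> bool" where
  "ito_integral M F W H I \<longleftrightarrow>
     progressive F H \<and>
     (\<forall>t\<ge>0. (\<integral>\<^sup>+\<omega>. (\<integral>\<^sup>+s\<in>{0..t}. ennreal ((H s \<omega>)\<^sup>2) \<partial>lborel) \<partial>M) < \<infinity>) \<and>
     adapted F I \<and> continuous_process M I \<and>
     (\<exists>n \<tau> \<xi>.
        (\<forall>k. simple_data M F (n k) (\<tau> k) (\<xi> k)) \<and>
        (\<forall>t\<ge>0.
          (\<lambda>k. \<integral>\<^sup>+\<omega>. (\<integral>\<^sup>+s\<in>{0..t}.
              ennreal ((simple_process (n k) (\<tau> k) (\<xi> k) s \<omega> - H s \<omega>)\<^sup>2) \<partial>lborel) \<partial>M)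
            \<longlonglongrightarrow> 0 \<and>
          (\<lambda>k. \<integral>\<^sup>+\<omega>.
              ennreal ((simple_integral (n k) (\<tau> k) (\<xi> k) W t \<omega> - I t \<omega>)\<^sup>2) \<partial>M)
            \<longlonglongrightarrow> 0))"

section \<open>Ito processes and local time\<close>

text \<open>\<open>dX = \<sigma> dW + b dt\<close>\<close>

definition ito_process ::
  "'a measure \<Rightarrow> (real \<Rightarrow> 'a measure) \<Rightarrow> (real \<Rightarrow> 'a \<Rightarrow> real) \<Rightarrow>
   (real \<Rightarrow> 'a \<Rightarrow> real) \<Rightarrow> (real \<Rightarrow> 'a \<Rightarrow> real) \<Rightarrow> (real \<Rightarrow> 'a \<Rightarrow> real) \<Rightarrow> bool" where
  "ito_process M F W \<sigma> b X \<longleftrightarrow>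
     adapted F X \<and> continuous_process M X \<and>
     (\<exists>I. ito_integral M F W \<sigma> I \<and>
       (AE \<omega> in M. \<forall>t\<ge>0.
          set_integrable lborel {0..t} (\<lambda>s. b s \<omega>) \<and>
          X t \<omega> = X 0 \<omega> + I t \<omega> + (LBINT s:{0..t}. b s \<omega>)))"

text \<open>\<open>J\<close> is the stochastic integral \<open>\<integral>\<^sub>0\<^sup>t H\<^sub>s dX\<^sub>s\<close> against an Ito process
  \<open>dX = \<sigma> dW + b dt\<close>. The decomposition of \<open>X\<close> into a continuous local martingale and a
  continuous process of finite variation is unique, so \<open>J\<close> depends on \<open>X\<close> only.\<close>

definition integral_wrt_ito_process ::
  "'a measure \<Rightarrow> (real \<Rightarrow> 'a measure) \<Rightarrow> (real \<Rightarrow> 'a \<Rightarrow> real) \<Rightarrow>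
   (real \<Rightarrow> 'a \<Rightarrow> real) \<Rightarrow> (real \<Rightarrow> 'a \<Rightarrow> real) \<Rightarrow>
   (real \<Rightarrow> 'a \<Rightarrow> real) \<Rightarrow> (real \<Rightarrow> 'a \<Rightarrow> real) \<Rightarrow> bool" where
  "integral_wrt_ito_process M F W \<sigma> b H J \<longleftrightarrow>
     (\<exists>I. ito_integral M F W (\<lambda>s \<omega>. H s \<omega> * \<sigma> s \<omega>) I \<and>
       (AE \<omega> in M. \<forall>t\<ge>0.
          set_integrable lborel {0..t} (\<lambda>s. H s \<omega> * b s \<omega>) \<and>
          J t \<omega> = I t \<omega> + (LBINT s:{0..t}. H s \<omega> * b s \<omega>)))"

text \<open>The local time at \<open>z\<close> in Tanaka's formula with the symmetric sign function
  (\<open>sgn 0 = 0\<close>).\<close>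

definition local_time ::
  "'a measure \<Rightarrow> (real \<Rightarrow> 'a measure) \<Rightarrow> (real \<Rightarrow> 'a \<Rightarrow> real) \<Rightarrow>
   (real \<Rightarrow> 'a \<Rightarrow> real) \<Rightarrow> (real \<Rightarrow> 'a \<Rightarrow> real) \<Rightarrow> (real \<Rightarrow> 'a \<Rightarrow> real) \<Rightarrow>
   real \<Rightarrow> (real \<Rightarrow> 'a \<Rightarrow> real) \<Rightarrow> bool" where
  "local_time M F W \<sigma> b X z L \<longleftrightarrow>
     ito_process M F W \<sigma> b X \<and>
     adapted F L \<and>
     (AE \<omega> in M. (\<forall>t\<ge>0. 0 \<le> L t \<omega>) \<and> mono_on {0..} (\<lambda>t. L t \<omega>)) \<and>
     (\<exists>J. integral_wrt_ito_process M F W \<sigma> b (\<lambda>s \<omega>. sgn (X s \<omega> - z)) J \<and>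
       (AE \<omega> in M. \<forall>t\<ge>0. \<bar>X t \<omega> - z\<bar> = \<bar>X 0 \<omega> - z\<bar> + J t \<omega> + L t \<omega>))"

text \<open>\<open>L z t \<omega>\<close> is the local time at level \<open>z\<close> up to time \<open>t\<close>, in a version jointly
  continuous in \<open>(t, z)\<close> outside a null set.\<close>

definition continuous_local_time ::
  "'a measure \<Rightarrow> (real \<Rightarrow> 'a measure) \<Rightarrow> (real \<Rightarrow> 'a \<Rightarrow> real) \<Rightarrow>
   (real \<Rightarrow> 'a \<Rightarrow> real) \<Rightarrow> (real \<Rightarrow> 'a \<Rightarrow> real) \<Rightarrow> (real \<Rightarrow> 'a \<Rightarrow> real) \<Rightarrow>
   (real \<Rightarrow> real \<Rightarrow> 'a \<Rightarrow> real) \<Rightarrow> bool" where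
  "continuous_local_time M F W \<sigma> b X L \<longleftrightarrow>
     (\<forall>z. local_time M F W \<sigma> b X z (L z)) \<and>
     (AE \<omega> in M. continuous_on ({0..} \<times> UNIV) (\<lambda>(t, z). L z t \<omega>))"

section \<open>The Barenblatt profile in dimension one\<close>

definition bb_beta :: "real \<Rightarrow> real \<Rightarrow> real" where
  "bb_beta p m = p + m * (p - 1) - 1"

definition bb_gamma :: "real \<Rightarrow> real \<Rightarrow> real" where
  "bb_gamma p m = (p - 1) / (m * (p - 1) - 1)"

definition bb_kappa :: "real \<Rightarrow> real \<Rightarrow> real" where
  "bb_kappa p m = (m * (p - 1) - 1) / (m * p) * bb_beta p m powr (- 1 / (p - 1))"

definition bb_S :: "real \<Rightarrow> real \<Rightarrow> real \<Rightarrow> real \<Rightarrow> real \<Rightarrow> real" where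
  "bb_S p m C t r = C - bb_kappa p m * (t powr (- 1 / bb_beta p m) * r) powr (p / (p - 1))"

definition bb_U_of :: "real \<Rightarrow> real \<Rightarrow> real \<Rightarrow> real \<Rightarrow> real \<Rightarrow> real" where
  "bb_U_of p m C t r = t powr (- 1 / bb_beta p m) * max (bb_S p m C t r) 0 powr bb_gamma p m"

definition bb_C :: "real \<Rightarrow> real \<Rightarrow> real" where
  "bb_C p m = (THE C. 0 < C \<and> (\<forall>t>0. 2 * (LBINT r:{0..}. bb_U_of p m C t r) = 1))"

definition bb_U :: "real \<Rightarrow> real \<Rightarrow> real \<Rightarrow> real \<Rightarrow> real" where
  "bb_U p m = bb_U_of p m (bb_C p m)"

definition bb_rho :: "real \<Rightarrow> real \<Rightarrow> real" where
  "bb_rho p m = (bb_C p m / bb_kappa p m) powr ((p - 1) / p)"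

definition barenblatt :: "real \<Rightarrow> real \<Rightarrow> real \<Rightarrow> real \<Rightarrow> real \<Rightarrow> real" where
  "barenblatt p m x t y = bb_U p m t \<bar>y - x\<bar>"

definition coeff_a :: "real \<Rightarrow> real \<Rightarrow> real \<Rightarrow> real \<Rightarrow> real" where
  "coeff_a p m t r =
     (if 0 < r \<and> r < bb_rho p m * t powr (1 / bb_beta p m)
      then m powr (p - 1) * \<bar>deriv (bb_U p m t) r\<bar> powr (p - 2)
             * bb_U p m t r powr ((m - 1) * (p - 1))
      else 0)"

definition coeff_a_r :: "real \<Rightarrow> real \<Rightarrow> real \<Rightarrow> real \<Rightarrow> real" where
  "coeff_a_r p m t r =
     (if 0 < r \<and> r < bb_rho p m * t powr (1 / bb_beta p m)
      then deriv (coeff_a p m t) r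
      else 0)"

section \<open>Probabilistically weak solutions\<close>

definition diffusion :: "real \<Rightarrow> real \<Rightarrow> real \<Rightarrow> (real \<Rightarrow> 'a \<Rightarrow> real) \<Rightarrow> real \<Rightarrow> 'a \<Rightarrow> real" where
  "diffusion p m x X s \<omega> = sqrt (2 * coeff_a p m s \<bar>X s \<omega> - x\<bar>)"

definition drift :: "real \<Rightarrow> real \<Rightarrow> real \<Rightarrow> (real \<Rightarrow> 'a \<Rightarrow> real) \<Rightarrow> real \<Rightarrow> 'a \<Rightarrow> real" where
  "drift p m x X s \<omega> = coeff_a_r p m s \<bar>X s \<omega> - x\<bar> * sgn (X s \<omega> - x)"

definition weak_solution ::
  "real \<Rightarrow> real \<Rightarrow> real \<Rightarrow> 'a measure \<Rightarrow> (real \<Rightarrow> 'a measure) \<Rightarrow>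
   (real \<Rightarrow> 'a \<Rightarrow> real) \<Rightarrow> (real \<Rightarrow> 'a \<Rightarrow> real) \<Rightarrow> bool" where
  "weak_solution p m x M F W X \<longleftrightarrow>
     stochastic_basis M F \<and> brownian_motion M F W \<and>
     adapted F X \<and> continuous_process M X \<and>
     (\<forall>t>0.
        (\<integral>\<^sup>+\<omega>. (\<integral>\<^sup>+s\<in>{0..t}. ennreal (coeff_a p m s \<bar>X s \<omega> - x\<bar>) \<partial>lborel) \<partial>M) < \<infinity> \<and>
        (\<integral>\<^sup>+\<omega>. (\<integral>\<^sup>+s\<in>{0..t}. ennreal \<bar>coeff_a_r p m s \<bar>X s \<omega> - x\<bar>\<bar> \<partial>lborel) \<partial>M) < \<infinity>) \<and>
     ito_process M F W (diffusion p m x X) (drift p m x X) X \<and>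
     (\<forall>t>0. distributed M lborel (X t) (\<lambda>y. ennreal (barenblatt p m x t y)))"

end

theory Submission
  imports Defs
begin

text \<open>The stochastic integral in Tanaka's formula has mean zero, so the mean local time at \<open>z\<close> is
  \<open>E |X\<^sub>t - z| - |x - z|\<close> minus the mean of \<open>\<integral> sgn (X\<^sub>s - z) dX\<^sub>s\<close>, and the latter only sees the drift.
  Both terms depend on the known laws \<open>w\<^sub>s\<close> of \<open>X\<^sub>s\<close> alone. By self-similarity
  \<open>X\<^sub>t - x\<close> has the law of \<open>t\<^sup>1\<^sup>/\<^sup>\<beta> (X\<^sub>1 - x)\<close>, so the first is
  \<open>\<integral>\<integral> sgn (y - z) (y - x) / (\<beta> s) w\<^sub>s(y) dy ds\<close>. The Barenblatt profile
  satisfies \<open>a \<partial>\<^sub>r U = - r U / (\<beta> t)\<close>, hence the difference of the two terms is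
  \<open>- \<integral>\<integral> sgn (y - z) \<partial>\<^sub>y (a w\<^sub>s) dy ds = 2 \<integral> (a w\<^sub>s)(z) ds\<close>.\<close>

section \<open>Mean of the stochastic integral and of the local time\<close>

lemma (in stochastic_basis) measurable_F_M:
  assumes "0 \<le> t" "f \<in> borel_measurable (F t)"
  shows "f \<in> borel_measurable M"
  using measurable_from_subalg[OF subalgebra_F[OF assms(1)] assms(2)] .

text \<open>Each summand is a bounded factor known at the left endpoint times a later Brownian
  increment. The increment is centred and independent of the past, so the expectation of the product
  factors and vanishes.\<close>

lemma (in stochastic_basis) simple_integral_mean_zero:
  assumes W: "brownian_motion M F W" and sd: "simple_data M F n \<tau> \<xi>" and t: "0 \<le> t"
  shows "integrable M (simple_integral n \<tau> \<xi> W t)"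
    and "expectation (simple_integral n \<tau> \<xi> W t) = 0"
proof -
  have \<tau>_nonneg: "0 \<le> \<tau> i" if "i \<le> n" for i
    using that
  proof (induction i)
    case 0 then show ?case using sd by (simp add: simple_data_def)
  next
    case (Suc i)
    then have "\<tau> i \<le> \<tau> (Suc i)" using sd by (simp add: simple_data_def)
    with Suc show ?case by simp
  qed
  have step: "integrable M (\<lambda>\<omega>. \<xi> i \<omega> * (W (min t (\<tau> (Suc i))) \<omega> - W (min t (\<tau> i)) \<omega>)) \<and>
      expectation (\<lambda>\<omega>. \<xi> i \<omega> * (W (min t (\<tau> (Suc i))) \<omega> - W (min t (\<tau> i)) \<omega>)) = 0"
    if i: "i < n" for i
  \<comment> \<open>\<open>brownian_motion\<close> describes increments over intervals of positive
    length only. An interval that is empty, or is cut to length zero by \<open>t\<close>, gives a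
    zero summand.\<close>
  proof (cases "min t (\<tau> i) < min t (\<tau> (Suc i))")
    case False
    moreover have "\<tau> i \<le> \<tau> (Suc i)" using sd i by (simp add: simple_data_def)
    ultimately have "min t (\<tau> i) = min t (\<tau> (Suc i))" by linarith
    then show ?thesis by simp
  next
    case True
    \<comment> \<open>Here \<open>\<tau> i < t\<close>, so the truncated left endpoint is
      \<open>\<tau> i\<close> itself, the time at which \<open>\<xi> i\<close> is
      measurable.\<close>
    define r s where "r = \<tau> i" and "s = min t (\<tau> (Suc i))"
    have rs: "0 \<le> r" "r < s" "min t (\<tau> i) = r"
      using True \<tau>_nonneg[of i] i by (auto simp: r_def s_def)
    let ?Y = "\<lambda>\<omega>. W s \<omega> - W r \<omega>"
    have dist: "distributed M lborel ?Y (\<lambda>y. ennreal (normal_density 0 (sqrt (s - r)) y))"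
      and indep: "indep_set (sets (F r)) (sets (vimage_algebra (space M) ?Y borel))"
      using W rs unfolding brownian_motion_def by auto
    have \<xi>F: "\<xi> i \<in> borel_measurable (F r)"
      using sd i by (simp add: simple_data_def r_def)
    obtain B where B: "\<And>\<omega>. \<omega> \<in> space M \<Longrightarrow> \<bar>\<xi> i \<omega>\<bar> \<le> B"
      using sd i unfolding simple_data_def by blast
    have \<xi>M[measurable]: "\<xi> i \<in> borel_measurable M"
      using measurable_F_M[OF rs(1) \<xi>F] .
    have YM[measurable]: "?Y \<in> borel_measurable M"
      using distributed_measurable[OF dist] by simp
    have spF: "space (F r) = space M"
      using subalgebra_F[OF rs(1)] by (simp add: subalgebra_def)
    have iv: "indep_var borel (\<xi> i) borel ?Y"
      unfolding indep_var_eq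
    proof (intro conjI)
      have A: "sigma_sets (space M) {\<xi> i -` A \<inter> space M |A. A \<in> sets borel} \<subseteq> sets (F r)"
        using \<xi>F spF by (intro sets.sigma_sets_subset[of _ "F r", unfolded spF])
          (auto simp: measurable_def)
      have B: "sigma_sets (space M) {?Y -` A \<inter> space M |A. A \<in> sets borel}
          \<subseteq> sets (vimage_algebra (space M) ?Y borel)"
        by (simp add: sets_vimage_algebra)
      show "indep_set (sigma_sets (space M) {\<xi> i -` A \<inter> space M |A. A \<in> sets borel})
         (sigma_sets (space M) {?Y -` A \<inter> space M |A. A \<in> sets borel})"
        using indep A B unfolding indep_set_def
        by - (erule indep_sets_mono_sets, auto split: bool.split)
    qed auto
    have sd0: "0 < sqrt (s - r)" using rs by simp
    have int\<xi>: "integrable M (\<xi> i)"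
      by (rule integrable_const_bound[of _ B]) (auto simp: B)
    have intY: "integrable M ?Y"
      using distributed_integrable_var[OF dist] integrable_normal_moment_nz_1[OF sd0, of 0] by simp
    have EY: "expectation ?Y = 0"
      using distributed_integral[OF dist, of "\<lambda>y. y"] integral_normal_moment_nz_1[OF sd0, of 0] by simp
    show ?thesis
      using indep_var_integrable[OF iv int\<xi> intY] indep_var_lebesgue_integral[OF iv int\<xi> intY] EY
      by (simp add: rs(3) flip: s_def)
  qed
  have eq: "simple_integral n \<tau> \<xi> W t =
      (\<lambda>\<omega>. \<Sum>i<n. \<xi> i \<omega> * (W (min t (\<tau> (Suc i))) \<omega> - W (min t (\<tau> i)) \<omega>))"
    by (simp add: fun_eq_iff simple_integral_def)
  show "integrable M (simple_integral n \<tau> \<xi> W t)"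
    unfolding eq using step by (intro Bochner_Integration.integrable_sum) auto
  show "expectation (simple_integral n \<tau> \<xi> W t) = 0"
    unfolding eq using step by (subst Bochner_Integration.integral_sum) auto
qed

text \<open>The approximating integrals \<open>?S k\<close> have mean zero, so the square of the
  mean of \<open>I t\<close> is at most the mean square of \<open>?S k - I t\<close>, which becomes
  arbitrarily small.\<close>

lemma (in stochastic_basis) ito_integral_mean_zero:
  assumes W: "brownian_motion M F W" and I: "ito_integral M F W H I" and t: "0 \<le> t"
  shows "integrable M (I t)" and "expectation (I t) = 0"
proof -
  obtain n \<tau> \<xi> where sd: "\<And>k. simple_data M F (n k) (\<tau> k) (\<xi> k)"
    and lim: "(\<lambda>k. \<integral>\<^sup>+\<omega>. ennreal ((simple_integral (n k) (\<tau> k) (\<xi> k) W t \<omega> - I t \<omega>)\<^sup>2) \<partial>M)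
            \<longlonglongrightarrow> 0"
    using I t unfolding ito_integral_def by blast
  have IM[measurable]: "I t \<in> borel_measurable M"
    using I t by (auto simp: ito_integral_def adapted_def intro: measurable_F_M)
  let ?S = "\<lambda>k. simple_integral (n k) (\<tau> k) (\<xi> k) W t"
  have Sint: "integrable M (?S k)" and S0: "expectation (?S k) = 0" for k
    using simple_integral_mean_zero[OF W sd t] by auto
  have SM[measurable]: "?S k \<in> borel_measurable M" for k using Sint[of k] by simp
  have near: "\<exists>k. integrable M (\<lambda>\<omega>. (?S k \<omega> - I t \<omega>)\<^sup>2) \<and> expectation (\<lambda>\<omega>. (?S k \<omega> - I t \<omega>)\<^sup>2) < e"
    if e: "0 < e" for e
  proof -
    obtain k where k: "(\<integral>\<^sup>+\<omega>. ennreal ((?S k \<omega> - I t \<omega>)\<^sup>2) \<partial>M) < ennreal e"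
      using eventually_happens[OF order_tendstoD(2)[OF lim, of "ennreal e"]] e
      by auto
    have i: "integrable M (\<lambda>\<omega>. (?S k \<omega> - I t \<omega>)\<^sup>2)"
      using k by (intro integrableI_bounded) (auto intro: order_less_trans[OF k])
    have "ennreal (expectation (\<lambda>\<omega>. (?S k \<omega> - I t \<omega>)\<^sup>2)) < ennreal e"
      using k by (subst nn_integral_eq_integral[OF i, symmetric]) auto
    then show ?thesis using i by (auto simp: ennreal_less_iff)
  qed
  have diff_int: "integrable M (\<lambda>\<omega>. ?S k \<omega> - I t \<omega>)"
    if "integrable M (\<lambda>\<omega>. (?S k \<omega> - I t \<omega>)\<^sup>2)" for k
    using square_integrable_imp_integrable[OF _ that] by simp
  obtain k where k: "integrable M (\<lambda>\<omega>. (?S k \<omega> - I t \<omega>)\<^sup>2)" using near[OF zero_less_one] by blast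
  have "integrable M (\<lambda>\<omega>. ?S k \<omega> - (?S k \<omega> - I t \<omega>))"
    by (rule Bochner_Integration.integrable_diff[OF Sint diff_int[OF k]])
  then show Iint: "integrable M (I t)" by simp
  have small: "(expectation (I t))\<^sup>2 < e" if e: "0 < e" for e
  proof -
    obtain k where k: "integrable M (\<lambda>\<omega>. (?S k \<omega> - I t \<omega>)\<^sup>2)"
        "expectation (\<lambda>\<omega>. (?S k \<omega> - I t \<omega>)\<^sup>2) < e"
      using near[OF e] by blast
    \<comment> \<open>Nonnegativity of the variance plays the part of the Cauchy-Schwarz
      inequality.\<close>
    have "(expectation (\<lambda>\<omega>. ?S k \<omega> - I t \<omega>))\<^sup>2 \<le> expectation (\<lambda>\<omega>. (?S k \<omega> - I t \<omega>)\<^sup>2)"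
      using variance_eq[OF diff_int[OF k(1)] k(1)]
        variance_positive[of "\<lambda>\<omega>. ?S k \<omega> - I t \<omega>"] by linarith
    moreover have "expectation (\<lambda>\<omega>. ?S k \<omega> - I t \<omega>) = - expectation (I t)"
      using Sint Iint by (simp add: S0)
    ultimately show ?thesis using k(2) by simp
  qed
  have "(expectation (I t))\<^sup>2 \<le> 0"
  proof (rule field_le_epsilon)
    show "(expectation (I t))\<^sup>2 \<le> 0 + e" if "0 < e" for e
      using small[OF that] by simp
  qed
  then show "expectation (I t) = 0" by simp
qed

text \<open>Path continuity makes the process a pointwise limit of processes frozen at grid times,
  each involving countably many measurable variables. The \<open>max 0 s\<close> extends the process
  to all real times, since nothing is known before time zero.\<close>

lemma (in stochastic_basis) measurable_continuous_process:
  assumes X: "continuous_process M X" and meas: "\<And>s. 0 \<le> s \<Longrightarrow> X s \<in> borel_measurable M"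
  shows "(\<lambda>(\<omega>, s). X (max 0 s) \<omega>) \<in> borel_measurable (M \<Otimes>\<^sub>M borel)"
proof -
  \<comment> \<open>Rounding down to the grid of mesh \<open>1 / (i + 1)\<close>; the shift by one
    avoids a division by zero at \<open>i = 0\<close>.\<close>
  let ?r = "\<lambda>(i::nat) s::real. real (nat \<lfloor>(real i + 1) * max 0 s\<rfloor>) / (real i + 1)"
  show ?thesis
  proof (rule borel_measurable_LIMSEQ_real[where u="\<lambda>i (\<omega>, s). X (?r i s) \<omega>"])
    show "(\<lambda>(\<omega>, s). X (?r i s) \<omega>) \<in> borel_measurable (M \<Otimes>\<^sub>M borel)" for i
    proof -
      have "(\<lambda>z. (\<lambda>j z. X (real j / (real i + 1)) (fst z)) (nat \<lfloor>(real i + 1) * max 0 (snd z)\<rfloor>) z)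
          \<in> borel_measurable (M \<Otimes>\<^sub>M (borel :: real measure))"
      proof (rule measurable_compose_countable[where f="\<lambda>j z. X (real j / (real i + 1)) (fst z)"
            and g="\<lambda>z. nat \<lfloor>(real i + 1) * max 0 (snd z)\<rfloor>"])
        have "X (real j / (real i + 1)) \<in> borel_measurable M" for j by (rule meas) simp
        then show "(\<lambda>z. X (real j / (real i + 1)) (fst z)) \<in> borel_measurable (M \<Otimes>\<^sub>M borel)" for j
          by measurable
        show "(\<lambda>z. nat \<lfloor>(real i + 1) * max 0 (snd z)\<rfloor>) \<in> M \<Otimes>\<^sub>M borel \<rightarrow>\<^sub>M count_space UNIV"
          by measurable
      qed
      then show ?thesis by (simp add: case_prod_beta')
    qed
  next
    fix z assume "z \<in> space (M \<Otimes>\<^sub>M (borel :: real measure))"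
    then have \<omega>: "fst z \<in> space M" by (auto simp: space_pair_measure)
    define s where "s = max 0 (snd z)"
    have s: "0 \<le> s" by (simp add: s_def)
    have "(\<lambda>i. ?r i (snd z)) \<longlonglongrightarrow> s"
    proof (rule tendsto_sandwich)
      have *: "real (nat \<lfloor>(real i + 1) * s\<rfloor>) \<le> (real i + 1) * s"
        "(real i + 1) * s - 1 \<le> real (nat \<lfloor>(real i + 1) * s\<rfloor>)" for i
      proof -
        have "0 \<le> (real i + 1) * s" using s by simp
        then have "real (nat \<lfloor>(real i + 1) * s\<rfloor>) = of_int \<lfloor>(real i + 1) * s\<rfloor>" by simp
        then show "real (nat \<lfloor>(real i + 1) * s\<rfloor>) \<le> (real i + 1) * s"
          "(real i + 1) * s - 1 \<le> real (nat \<lfloor>(real i + 1) * s\<rfloor>)"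
          by linarith+
      qed
      show "\<forall>\<^sub>F i in sequentially. s - 1 / (real i + 1) \<le> ?r i (snd z)"
      proof (intro always_eventually allI)
        fix i
        have "s - 1 / (real i + 1) = ((real i + 1) * s - 1) / (real i + 1)" by (simp add: field_simps)
        also have "\<dots> \<le> ?r i (snd z)"
          unfolding s_def[symmetric] by (intro divide_right_mono *) simp
        finally show "s - 1 / (real i + 1) \<le> ?r i (snd z)" .
      qed
      show "\<forall>\<^sub>F i in sequentially. ?r i (snd z) \<le> s"
        using * by (intro always_eventually allI) (simp add: field_simps flip: s_def)
      have "(\<lambda>i. s - 1 / real (Suc i)) \<longlonglongrightarrow> s - 0"
        using LIMSEQ_inverse_real_of_nat by (intro tendsto_intros) (simp add: inverse_eq_divide)
      then show "(\<lambda>i. s - 1 / (real i + 1)) \<longlonglongrightarrow> s" by (simp add: add.commute)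
    qed simp
    moreover have "continuous_on {0..} (\<lambda>u. X u (fst z))"
      using X \<omega> by (simp add: continuous_process_def)
    ultimately have "(\<lambda>i. X (?r i (snd z)) (fst z)) \<longlonglongrightarrow> X s (fst z)"
      using s by - (rule continuous_on_tendsto_compose[of "{0..}" "\<lambda>u. X u (fst z)"], auto)
    then show "(\<lambda>i. case z of (\<omega>, s) \<Rightarrow> X (?r i s) \<omega>) \<longlonglongrightarrow> (case z of (\<omega>, s) \<Rightarrow> X (max 0 s) \<omega>)"
      unfolding s_def case_prod_beta' .
  qed
qed

text \<open>Tanaka's formula is solved for \<open>L t\<close>, and the martingale part of the
  integral against \<open>X\<close> drops out in the mean. Integrability of the remaining terms is a
  hypothesis here and is later obtained from the law of the solution.\<close>

lemma (in stochastic_basis) local_time_mean: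
  assumes W: "brownian_motion M F W" and L: "local_time M F W \<sigma> b X z L" and t: "0 \<le> t"
    and Xt: "integrable M (\<lambda>\<omega>. \<bar>X t \<omega> - z\<bar>)" and X0: "integrable M (\<lambda>\<omega>. \<bar>X 0 \<omega> - z\<bar>)"
    and B: "integrable M (\<lambda>\<omega>. LBINT s:{0..t}. sgn (X s \<omega> - z) * b s \<omega>)"
  shows "integrable M (L t)"
    and "expectation (L t) = expectation (\<lambda>\<omega>. \<bar>X t \<omega> - z\<bar>) - expectation (\<lambda>\<omega>. \<bar>X 0 \<omega> - z\<bar>)
      - expectation (\<lambda>\<omega>. LBINT s:{0..t}. sgn (X s \<omega> - z) * b s \<omega>)"
proof -
  obtain J where J: "integral_wrt_ito_process M F W \<sigma> b (\<lambda>s \<omega>. sgn (X s \<omega> - z)) J"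
    and tanaka: "AE \<omega> in M. \<forall>t\<ge>0. \<bar>X t \<omega> - z\<bar> = \<bar>X 0 \<omega> - z\<bar> + J t \<omega> + L t \<omega>"
    using L unfolding local_time_def by blast
  obtain I where I: "ito_integral M F W (\<lambda>s \<omega>. sgn (X s \<omega> - z) * \<sigma> s \<omega>) I"
    and JI: "AE \<omega> in M. \<forall>t\<ge>0. set_integrable lborel {0..t} (\<lambda>s. sgn (X s \<omega> - z) * b s \<omega>) \<and>
          J t \<omega> = I t \<omega> + (LBINT s:{0..t}. sgn (X s \<omega> - z) * b s \<omega>)"
    using J unfolding integral_wrt_ito_process_def by blast
  note It = ito_integral_mean_zero[OF W I t]
  let ?R = "\<lambda>\<omega>. \<bar>X t \<omega> - z\<bar> - \<bar>X 0 \<omega> - z\<bar> - I t \<omega> - (LBINT s:{0..t}. sgn (X s \<omega> - z) * b s \<omega>)"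
  have R: "integrable M ?R"
    by (rule Bochner_Integration.integrable_diff[OF Bochner_Integration.integrable_diff[OF
          Bochner_Integration.integrable_diff[OF Xt X0] It(1)] B])
  have eq: "AE \<omega> in M. L t \<omega> = ?R \<omega>"
    using tanaka JI
  proof eventually_elim
    case (elim \<omega>)
    from elim(1)[rule_format, OF t] conjunct2[OF elim(2)[rule_format, OF t]] show ?case by linarith
  qed
  have Lm: "L t \<in> borel_measurable M"
    using L t by (auto simp: local_time_def adapted_def intro: measurable_F_M)
  show "integrable M (L t)"
    using integrable_cong_AE[OF Lm borel_measurable_integrable[OF R] eq] R by simp
  have "expectation (L t) = expectation ?R"
    by (rule integral_cong_AE[OF Lm borel_measurable_integrable[OF R] eq])
  also have "\<dots> = expectation (\<lambda>\<omega>. \<bar>X t \<omega> - z\<bar>) - expectation (\<lambda>\<omega>. \<bar>X 0 \<omega> - z\<bar>)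
      - expectation (\<lambda>\<omega>. LBINT s:{0..t}. sgn (X s \<omega> - z) * b s \<omega>)"
    using Xt X0 It B by simp
  finally show "expectation (L t) = \<dots>" .
qed

section \<open>The Barenblatt profile and its flux\<close>

lemma has_real_derivative_abs:
  assumes f: "(f has_real_derivative D) (at x)" and "f x \<noteq> 0"
  shows "((\<lambda>x. \<bar>f x\<bar>) has_real_derivative sgn (f x) * D) (at x)"
proof -
  have "(abs has_real_derivative sgn y) (at y)" if "y \<noteq> 0" for y :: real
  proof (cases "0 < y")
    case True
    show ?thesis
      by (rule has_field_derivative_transform_within_open[of "\<lambda>y. y" _ _ "{0<..}"])
        (use True in auto)
  next
    case False
    show ?thesis
      by (rule has_field_derivative_transform_within_open[of uminus _ _ "{..<0}"])
        (use False that in \<open>auto intro!: derivative_eq_intros\<close>)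
  qed
  from DERIV_chain2[OF this f] assms(2) show ?thesis by simp
qed

text \<open>\<open>bb_C\<close> is a definite description; its sign is read off from the law
  instead. With a nonpositive constant the profile would vanish identically, and a zero function
  cannot be a probability density.\<close>

lemma (in prob_space) bb_C_pos_if_density:
  assumes par: "2 < p" "0 < m" "1 < m * (p - 1)"
    and d: "distributed M lborel Y (\<lambda>y. ennreal (barenblatt p m x t y))"
  shows "0 < bb_C p m"
proof (rule ccontr)
  assume C: "\<not> 0 < bb_C p m"
  have "0 < bb_kappa p m" using par by (simp add: bb_kappa_def bb_beta_def)
  then have "bb_S p m (bb_C p m) t r \<le> 0" for r
    using C unfolding bb_S_def by (smt (verit) mult_nonneg_nonneg powr_ge_zero)
  then have "barenblatt p m x t y = 0" for y
    by (simp add: barenblatt_def bb_U_def bb_U_of_def max_absorb2)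
  then have "(\<integral>\<^sup>+\<omega>. 1 \<partial>M) = 0"
    using distributed_nn_integral[OF d, of "\<lambda>_. 1"] by simp
  then show False by (simp add: emeasure_space_1)
qed

locale barenblatt_params =
  fixes p m :: real
  assumes p: "2 < p" and m: "0 < m" and mp: "1 < m * (p - 1)" and C_pos: "0 < bb_C p m"
begin

abbreviation "\<beta> \<equiv> bb_beta p m"
abbreviation "\<gamma> \<equiv> bb_gamma p m"
abbreviation "\<kappa> \<equiv> bb_kappa p m"
abbreviation "C \<equiv> bb_C p m"
abbreviation "S \<equiv> bb_S p m C"
abbreviation "U \<equiv> bb_U p m"
abbreviation "a \<equiv> coeff_a p m"
abbreviation "a_r \<equiv> coeff_a_r p m"

definition "dil t = t powr (- 1 / \<beta>)"
definition "e = p / (p - 1)"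
text \<open>The exponent of \<open>r\<close> in the coefficient \<open>a\<close>. It is positive
  because \<open>p > 2\<close>, so \<open>a\<close> tends to zero at the centre, in agreement with
  its prescribed value there.\<close>

definition "q = (p - 2) / (p - 1)"
definition "radius t = bb_rho p m * t powr (1 / \<beta>)"

section \<open>Signs of the parameters and the support of the profile\<close>

lemma beta_pos: "1 < \<beta>" using p mp by (simp add: bb_beta_def)
lemma gamma_pos: "0 < \<gamma>" using p mp by (simp add: bb_gamma_def)
lemma kappa_pos: "0 < \<kappa>"
  using p m mp beta_pos by (simp add: bb_kappa_def)
lemma e_pos: "1 < e" using p by (simp add: e_def)
lemma q_pos: "0 < q" using p by (simp add: q_def)
lemma dil_pos: "0 < t \<Longrightarrow> 0 < dil t" by (simp add: dil_def)
lemma rho_pos: "0 < bb_rho p m" using C_pos kappa_pos by (simp add: bb_rho_def)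
lemma radius_pos: "0 < t \<Longrightarrow> 0 < radius t" using rho_pos by (simp add: radius_def)

lemma S_eq: "S t r = C - \<kappa> * (dil t * r) powr e"
  by (simp add: bb_S_def dil_def e_def)

lemma U_eq: "U t r = dil t * max (S t r) 0 powr \<gamma>"
  by (simp add: bb_U_def bb_U_of_def dil_def)

lemma U_nonneg: "0 \<le> U s r"
  by (simp add: U_eq dil_def)

lemma S_pos_iff:
  assumes t: "0 < t" and r: "0 \<le> r"
  shows "0 < S t r \<longleftrightarrow> r < radius t"
proof -
  have Ck: "0 < C / \<kappa>" using C_pos kappa_pos by simp
  have "0 < S t r \<longleftrightarrow> (dil t * r) powr e < C / \<kappa>"
    using kappa_pos by (simp add: S_eq field_simps)
  also have "C / \<kappa> = ((C / \<kappa>) powr (1 / e)) powr e"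
    using C_pos kappa_pos e_pos by (simp add: powr_powr)
  also have "(dil t * r) powr e < ((C / \<kappa>) powr (1 / e)) powr e \<longleftrightarrow> dil t * r < (C / \<kappa>) powr (1 / e)"
    using e_pos r dil_pos[OF t] powr_less_mono2[of e "dil t * r" "(C / \<kappa>) powr (1 / e)"]
      powr_mono2[of e "(C / \<kappa>) powr (1 / e)" "dil t * r"] by force
  also have "(C / \<kappa>) powr (1 / e) = bb_rho p m" by (simp add: bb_rho_def e_def)
  also have "dil t * r < bb_rho p m \<longleftrightarrow> r < radius t"
    using t by (simp add: dil_def radius_def powr_minus field_simps)
  finally show ?thesis .
qed

lemma S_nonpos: "0 < t \<Longrightarrow> radius t \<le> r \<Longrightarrow> S t r \<le> 0"
  using S_pos_iff[of t r] radius_pos[of t] by force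

lemma U_outside: "0 < t \<Longrightarrow> radius t \<le> r \<Longrightarrow> U t r = 0"
  using S_nonpos[of t r] by (simp add: U_eq max_absorb2)

lemma U_inside: "0 < t \<Longrightarrow> 0 \<le> r \<Longrightarrow> r < radius t \<Longrightarrow> U t r = dil t * S t r powr \<gamma>"
  using S_pos_iff[of t r] by (simp add: U_eq)

section \<open>Radial derivatives inside the support\<close>

lemma deriv_S:
  assumes t: "0 < t" and r: "0 < r"
  shows "(S t has_real_derivative - (\<kappa> * e * dil t powr e * r powr (e - 1))) (at r)"
proof -
  have "((\<lambda>r. C - \<kappa> * (dil t powr e * r powr e)) has_real_derivative
      - (\<kappa> * e * dil t powr e * r powr (e - 1))) (at r)"
    using r by (auto intro!: derivative_eq_intros)
  moreover have "eventually (\<lambda>r. S t r = C - \<kappa> * (dil t powr e * r powr e)) (nhds r)"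
    using eventually_nhds_in_open[of "{0<..}" r] r
    by (rule_tac eventually_mono) (auto simp: S_eq powr_mult dil_pos[OF t] less_imp_le)
  ultimately show ?thesis by (subst DERIV_cong_ev[OF refl _ refl]) auto
qed

lemma eventually_inside:
  assumes "0 < r" "r < radius t"
  shows "eventually (\<lambda>r. 0 < r \<and> r < radius t) (nhds r)"
  using eventually_nhds_in_open[of "{0<..<radius t}" r] assms by simp

lemma deriv_U:
  assumes t: "0 < t" and r: "0 < r" "r < radius t"
  shows "(U t has_real_derivative
    - (dil t * \<gamma> * S t r powr (\<gamma> - 1) * (\<kappa> * e * dil t powr e * r powr (e - 1)))) (at r)"
proof -
  have S: "0 < S t r" using S_pos_iff[OF t] r by simp
  have "((\<lambda>r. dil t * S t r powr \<gamma>) has_real_derivative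
    - (dil t * \<gamma> * S t r powr (\<gamma> - 1) * (\<kappa> * e * dil t powr e * r powr (e - 1)))) (at r)"
    using S by (auto intro!: derivative_eq_intros deriv_S[OF t r(1)])
  moreover have "eventually (\<lambda>r. U t r = dil t * S t r powr \<gamma>) (nhds r)"
    using eventually_inside[OF r] by (rule eventually_mono) (simp add: U_inside[OF t])
  ultimately show ?thesis by (subst DERIV_cong_ev[OF refl _ refl]) auto
qed

text \<open>The factor of \<open>a t r\<close> that does not depend on \<open>r\<close>; see
  \<open>a_eq\<close>.\<close>

definition "a_const t = m powr (p - 1) * (\<gamma> * \<kappa> * e) powr (p - 2)
  * dil t powr ((p - 2) * (1 + e) + (m - 1) * (p - 1))"

text \<open>The value of \<gamma> is chosen so that the powers of \<open>S\<close> coming from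
  \<open>U\<close> and from its derivative add up to exactly one. Hence \<open>a\<close> is a power
  of \<open>r\<close> times \<open>S\<close>.\<close>

lemma a_eq:
  assumes t: "0 < t" and r: "0 < r" "r < radius t"
  shows "a t r = a_const t * r powr q * S t r"
proof -
  have S: "0 < S t r" using S_pos_iff[OF t] r by simp
  note sc = dil_pos[OF t]
  have exponent: "(\<gamma> - 1) * (p - 2) + \<gamma> * ((m - 1) * (p - 1)) = 1"
  proof -
    have "\<gamma> * (m * (p - 1) - 1) = p - 1" using mp by (simp add: bb_gamma_def)
    then show ?thesis by (simp add: algebra_simps)
  qed
  have e1: "e - 1 = 1 / (p - 1)" using p by (simp add: e_def field_simps)
  have d: "\<bar>deriv (U t) r\<bar> = dil t * \<gamma> * S t r powr (\<gamma> - 1) * (\<kappa> * e * dil t powr e * r powr (e - 1))"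
    using DERIV_imp_deriv[OF deriv_U[OF t r]] S sc gamma_pos kappa_pos e_pos r by (simp add: abs_mult)
  have "a t r = m powr (p - 1) * ((\<gamma> * \<kappa> * e) * (dil t powr (1 + e)) * (S t r powr (\<gamma> - 1) * r powr (e - 1))) powr (p - 2)
      * (dil t * S t r powr \<gamma>) powr ((m - 1) * (p - 1))"
    using r sc by (simp add: coeff_a_def d U_inside[OF t] powr_add flip: radius_def) (simp add: ac_simps)
  also have "\<dots> = a_const t * r powr ((e - 1) * (p - 2)) * S t r powr ((\<gamma> - 1) * (p - 2) + \<gamma> * ((m - 1) * (p - 1)))"
    using sc S r gamma_pos kappa_pos e_pos unfolding a_const_def
      powr_add[of "dil t" "(p - 2) * (1 + e)"] powr_add[of "S t r" "(\<gamma> - 1) * (p - 2)"]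
    by (simp add: powr_mult powr_powr ac_simps)
  finally show ?thesis using S r by (simp add: exponent e1 q_def)
qed

text \<open>This is where the values of \<beta> and \<kappa> enter. The exponents of
  \<open>dil t\<close> add up to \<beta>, which gives \<open>1 / t\<close>, and \<kappa> is
  normalised so that the \<open>(p - 1)\<close>-th power of \<open>\<gamma> * \<kappa> * e\<close>
  cancels \<open>m powr (p - 1)\<close> up to \<open>1 / \<beta>\<close>.\<close>

lemma a_const_dil: 
  assumes t: "0 < t"
  shows "a_const t * (\<gamma> * \<kappa> * e) * dil t powr e = 1 / (\<beta> * t)"
proof -
  note sc = dil_pos[OF t]
  have b: "(p - 2) * (1 + e) + (m - 1) * (p - 1) + e = \<beta>"
  proof -
    have "e * (p - 1) = p" using p by (simp add: e_def)
    then show ?thesis by (simp add: bb_beta_def algebra_simps)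
  qed
  have k: "\<gamma> * \<kappa> * e = \<beta> powr (- 1 / (p - 1)) / m"
  proof -
    have "n / d * (d / (m * p) * b) * (p / n) = b / m" if "n \<noteq> 0" "d \<noteq> 0" for n d b
      using that m p by (simp add: field_simps)
    from this[of "p - 1" "m * (p - 1) - 1"] show ?thesis
      using p mp by (simp add: bb_gamma_def bb_kappa_def e_def)
  qed
  have pos: "0 < \<gamma> * \<kappa> * e" using gamma_pos kappa_pos e_pos by simp
  have "a_const t * (\<gamma> * \<kappa> * e) * dil t powr e
      = m powr (p - 1) * ((\<gamma> * \<kappa> * e) powr (p - 2) * (\<gamma> * \<kappa> * e) powr 1) * dil t powr \<beta>"
    using pos unfolding a_const_def b[symmetric] powr_add by simp
  also have "(\<gamma> * \<kappa> * e) powr (p - 2) * (\<gamma> * \<kappa> * e) powr 1 = (\<gamma> * \<kappa> * e) powr (p - 1)"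
    unfolding powr_add[symmetric] by simp
  also have "m powr (p - 1) * (\<gamma> * \<kappa> * e) powr (p - 1) = 1 / \<beta>"
    unfolding k using p m beta_pos by (simp add: powr_divide powr_powr powr_mult powr_minus_divide)
  also have "dil t powr \<beta> = 1 / t"
    using t beta_pos by (simp add: dil_def powr_powr powr_minus_divide powr_divide)
  finally show ?thesis by simp
qed

text \<open>The once-integrated form of the self-similar equation. In the product the powers of
  \<open>r\<close> combine to \<open>q + (e - 1) = 1\<close> and those of \<open>S\<close> to
  \<gamma>, so \<open>U\<close> itself reappears.\<close>

lemma flux:
  assumes t: "0 < t" and r: "0 < r" "r < radius t"
  shows "a t r * deriv (U t) r = - (r / (\<beta> * t) * U t r)"
proof -
  have S: "0 < S t r" using S_pos_iff[OF t] r by simp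
  have qe: "q + (e - 1) = 1" using p by (simp add: q_def e_def field_simps)
  have "a t r * deriv (U t) r = - ((a_const t * (\<gamma> * \<kappa> * e) * dil t powr e)
       * (r powr q * r powr (e - 1)) * (dil t * (S t r powr 1 * S t r powr (\<gamma> - 1))))"
    using S by (simp add: a_eq[OF t r] DERIV_imp_deriv[OF deriv_U[OF t r]])
  also have "\<dots> = - ((1 / (\<beta> * t)) * r * (dil t * S t r powr \<gamma>))"
    unfolding powr_add[symmetric] a_const_dil[OF t] qe using r by simp
  finally show ?thesis using r by (simp add: U_inside[OF t])
qed

definition "a_r_explicit t r = a_const t * (q * r powr (q - 1) * S t r
    - r powr q * (\<kappa> * e * dil t powr e * r powr (e - 1)))"

lemma deriv_a:
  assumes t: "0 < t" and r: "0 < r" "r < radius t"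
  shows "(a t has_real_derivative a_r_explicit t r) (at r)"
proof -
  have "((\<lambda>r. a_const t * r powr q * S t r) has_real_derivative a_r_explicit t r) (at r)"
    using r unfolding a_r_explicit_def
    by (auto intro!: derivative_eq_intros deriv_S[OF t r(1)] simp: algebra_simps)
  moreover have "eventually (\<lambda>r. a t r = a_const t * r powr q * S t r) (nhds r)"
    using eventually_inside[OF r] by (rule eventually_mono) (simp add: a_eq[OF t])
  ultimately show ?thesis by (subst DERIV_cong_ev[OF refl _ refl]) auto
qed

text \<open>Replaces \<open>deriv\<close> by a formula that is visibly jointly measurable. At time
  zero the support is empty because \<open>0 powr (1 / \<beta>) = 0\<close>.\<close>

lemma a_r_eq:
  assumes t: "0 \<le> t"
  shows "a_r t r = (if 0 < t \<and> 0 < r \<and> r < radius t then a_r_explicit t r else 0)"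
proof (cases "t = 0")
  case True then show ?thesis by (simp add: coeff_a_r_def)
next
  case False
  then show ?thesis using t DERIV_imp_deriv[OF deriv_a, of t r]
    by (simp add: coeff_a_r_def flip: radius_def)
qed

section \<open>Regularity of the coefficients and of the product of \<open>a\<close> and
  \<open>U\<close>\<close>

lemma measurable_a_r:
  "(\<lambda>(t, r). if 0 < t \<and> 0 < r \<and> r < radius t then a_r_explicit t r else 0)
    \<in> borel_measurable (borel \<Otimes>\<^sub>M borel)"
  unfolding a_r_explicit_def S_eq radius_def dil_def a_const_def by measurable

lemma measurable_U: "(\<lambda>(t, r). U t r) \<in> borel_measurable (borel \<Otimes>\<^sub>M borel)"
  unfolding U_eq S_eq dil_def by measurable

text \<open>The prescribed zeros of \<open>a\<close> cause no jump in the product: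
  \<open>r powr q\<close> vanishes at the centre, and \<open>S powr (\<gamma> + 1)\<close> at the
  edge of the support. Integration by parts therefore picks up no boundary term at these
  points.\<close>

lemma aU_continuous:
  assumes t: "0 < t"
  shows "continuous_on {0..} (\<lambda>r. a t r * U t r)"
proof -
  have eq: "a t r * U t r = a_const t * r powr q * dil t * max (S t r) 0 powr (\<gamma> + 1)" if "0 \<le> r" for r
  proof (cases "0 < r \<and> r < radius t")
    case True
    then have S: "0 < S t r" using S_pos_iff[OF t] by simp
    with True show ?thesis by (simp add: a_eq[OF t] U_inside[OF t] powr_add max_absorb1)
  next
    case False
    then consider "r = 0" | "radius t \<le> r" using \<open>0 \<le> r\<close> by linarith
    then show ?thesis
    proof cases
      case 1 then show ?thesis using q_pos by (simp add: coeff_a_def)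
    next
      case 2 then show ?thesis using S_nonpos[OF t 2] by (simp add: coeff_a_def U_outside[OF t] max_absorb2)
    qed
  qed
  have "continuous_on {0..} (\<lambda>r. a_const t * r powr q * dil t * max (S t r) 0 powr (\<gamma> + 1))"
    unfolding S_eq using q_pos gamma_pos e_pos dil_pos[OF t]
    by (intro continuous_intros continuous_on_powr') auto
  then show ?thesis using eq by (subst continuous_on_cong[OF refl eq]) auto
qed

text \<open>The additional factor \<open>U\<close> raises the exponent in \<open>a\<close> by one,
  which yields the integrand of the theorem.\<close>

lemma aU_inside:
  assumes "0 < s" "0 < r" "r < radius s"
  shows "a s r * U s r = m powr (p - 1) * (\<bar>deriv (U s) r\<bar> powr (p - 2) * U s r powr ((m - 1) * (p - 1) + 1))"
proof -
  have "0 < U s r"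
    using assms dil_pos[of s] S_pos_iff[of s r] by (simp add: U_inside)
  then have "U s r powr ((m - 1) * (p - 1) + 1) = U s r powr ((m - 1) * (p - 1)) * U s r"
    unfolding powr_add by simp
  then show ?thesis using assms by (simp add: coeff_a_def flip: radius_def)
qed

lemma aU_nonneg: "0 \<le> a s r * U s r"
  by (simp add: coeff_a_def U_eq dil_def)

text \<open>The closed form from \<open>a_eq\<close> replaces the derivative inside
  \<open>a\<close>; the indicator removes negative times, where that form has not been
  established.\<close>

lemma measurable_aU: "(\<lambda>s. indicator {0..t} s * (a s r * U s r)) \<in> borel_measurable lborel"
proof -
  have "a s r = (if 0 < r \<and> r < radius s then a_const s * r powr q * S s r else 0)" if "0 \<le> s" for s
    using that a_eq[of s r] by (cases "s = 0") (auto simp: coeff_a_def radius_def)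
  then have "(\<lambda>s. indicator {0..t} s * (a s r * U s r)) = (\<lambda>s. indicator {0..t} s *
      ((if 0 < r \<and> r < radius s then a_const s * r powr q * S s r else 0) * U s r))"
    by (auto simp: fun_eq_iff indicator_def)
  also have "\<dots> \<in> borel_measurable lborel"
    unfolding radius_def a_const_def U_eq S_eq dil_def by measurable
  finally show ?thesis .
qed

lemma deriv_barenblatt:
  assumes "0 < s" "z \<noteq> x" "\<bar>z - x\<bar> < radius s"
  shows "\<bar>deriv (barenblatt p m x s) z\<bar> = \<bar>deriv (U s) \<bar>z - x\<bar>\<bar>"
proof -
  have "((\<lambda>y. y - x) has_real_derivative 1) (at z)" by (auto intro!: derivative_eq_intros)
  from has_real_derivative_abs[OF this] assms(2)
  have "((\<lambda>y. \<bar>y - x\<bar>) has_real_derivative sgn (z - x)) (at z)" by simp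
  moreover have "(U s has_real_derivative deriv (U s) \<bar>z - x\<bar>) (at \<bar>z - x\<bar>)"
    using deriv_U[OF assms(1), of "\<bar>z - x\<bar>"] assms by (metis DERIV_imp_deriv zero_less_abs_iff right_minus_eq)
  ultimately have "((\<lambda>y. U s \<bar>y - x\<bar>) has_real_derivative deriv (U s) \<bar>z - x\<bar> * sgn (z - x)) (at z)"
    by (rule DERIV_chain2[rotated])
  then have "deriv (barenblatt p m x s) z = deriv (U s) \<bar>z - x\<bar> * sgn (z - x)"
    unfolding barenblatt_def[abs_def] by (rule DERIV_imp_deriv)
  then show ?thesis using assms(2) by (simp add: abs_mult sgn_if)
qed

section \<open>Integration in space and in time\<close>

lemma integrable_weighted:
  assumes t: "0 < t" and g: "continuous_on UNIV g"
  shows "integrable lborel (\<lambda>y. g y * U t \<bar>y - x\<bar>)"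
proof -
  let ?K = "{x - radius t..x + radius t}"
  have "continuous_on ?K (\<lambda>y. g y * U t \<bar>y - x\<bar>)"
    unfolding U_eq S_eq using gamma_pos e_pos dil_pos[OF t]
    by (intro continuous_intros continuous_on_powr' continuous_on_subset[OF g]) auto
  then have "integrable lborel (\<lambda>y. indicator ?K y *\<^sub>R (g y * U t \<bar>y - x\<bar>))"
    by (intro borel_integrable_compact) auto
  also have "(\<lambda>y. indicator ?K y *\<^sub>R (g y * U t \<bar>y - x\<bar>)) = (\<lambda>y. g y * U t \<bar>y - x\<bar>)"
  proof
    fix y
    show "indicator ?K y *\<^sub>R (g y * U t \<bar>y - x\<bar>) = g y * U t \<bar>y - x\<bar>"
    proof (cases "y \<in> ?K")
      case False
      then have "radius t \<le> \<bar>y - x\<bar>" by auto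
      then show ?thesis using U_outside[OF t] False by simp
    qed simp
  qed
  finally show ?thesis .
qed

text \<open>In the product rule the term with the derivative of \<open>U\<close> is the flux, which
  \<open>flux\<close> turns into a multiple of \<open>U\<close>. Outside the support all terms
  vanish; the centre and the two edges are left out.\<close>

lemma aU_deriv:
  assumes t: "0 < t" and y: "y \<noteq> x" "\<bar>y - x\<bar> \<noteq> radius t"
  shows "((\<lambda>y. a t \<bar>y - x\<bar> * U t \<bar>y - x\<bar>) has_real_derivative
    a_r t \<bar>y - x\<bar> * sgn (y - x) * U t \<bar>y - x\<bar> - (y - x) / (\<beta> * t) * U t \<bar>y - x\<bar>) (at y)"
proof (cases "\<bar>y - x\<bar> < radius t")
  case True
  let ?r = "\<bar>y - x\<bar>"
  have r: "0 < ?r" "?r < radius t" using y True by auto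
  have U': "(U t has_real_derivative deriv (U t) ?r) (at ?r)"
    using deriv_U[OF t r] by (metis DERIV_imp_deriv)
  have a': "(a t has_real_derivative a_r t ?r) (at ?r)"
    using deriv_a[OF t r] t r by (simp add: a_r_eq)
  have "((\<lambda>r. a t r * U t r) has_real_derivative (a_r t ?r * U t ?r + deriv (U t) ?r * a t ?r)) (at ?r)"
    by (rule DERIV_mult[OF a' U'])
  moreover have "((\<lambda>y. \<bar>y - x\<bar>) has_real_derivative sgn (y - x)) (at y)"
  proof -
    have "((\<lambda>y. y - x) has_real_derivative 1) (at y)" by (auto intro!: derivative_eq_intros)
    from has_real_derivative_abs[OF this] y(1) show ?thesis by simp
  qed
  ultimately have "((\<lambda>y. a t \<bar>y - x\<bar> * U t \<bar>y - x\<bar>) has_real_derivative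
    (a_r t ?r * U t ?r + deriv (U t) ?r * a t ?r) * sgn (y - x)) (at y)"
    by (rule DERIV_chain2)
  moreover have "deriv (U t) ?r * a t ?r * sgn (y - x) = - ((y - x) / (\<beta> * t) * U t ?r)"
  proof -
    have "deriv (U t) ?r * a t ?r * sgn (y - x) = (a t ?r * deriv (U t) ?r) * sgn (y - x)"
      by (simp only: mult.commute)
    also have "\<dots> = - (sgn (y - x) * ?r / (\<beta> * t) * U t ?r)"
      unfolding flux[OF t r] by (simp add: ac_simps)
    finally show ?thesis by (simp only: sgn_mult_abs)
  qed
  ultimately show ?thesis by (simp add: algebra_simps)
next
  case False
  then have gt: "radius t < \<bar>y - x\<bar>" using y by simp
  have "eventually (\<lambda>y. y \<in> {y. radius t < \<bar>y - x\<bar>}) (nhds y)"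
    using gt by (intro eventually_nhds_in_open open_Collect_less continuous_intros) auto
  then have "eventually (\<lambda>y. a t \<bar>y - x\<bar> * U t \<bar>y - x\<bar> = 0) (nhds y)"
    by (rule eventually_mono) (simp add: U_outside[OF t])
  then have "((\<lambda>y. a t \<bar>y - x\<bar> * U t \<bar>y - x\<bar>) has_real_derivative 0) (at y)"
    by (subst DERIV_cong_ev[OF refl _ refl, where g="\<lambda>_. 0"]) auto
  then show ?thesis using gt by (simp add: U_outside[OF t])
qed

text \<open>Integrate the derivative of \<open>sgn (y - z) * (H y - H z)\<close>, where \<open>H y = a t \<bar>y - x\<bar> * U t \<bar>y - x\<bar>\<close>:
  this function is continuous across \<open>z\<close>, so the jump of the sign contributes no boundary term
  there.\<close>

lemma spatial_identity:
  fixes x z :: real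
  assumes t: "0 < t" and int: "integrable lborel (\<lambda>y. a_r t \<bar>y - x\<bar> * U t \<bar>y - x\<bar>)"
  shows "(\<integral>y. sgn (y - z) * (a_r t \<bar>y - x\<bar> * sgn (y - x)) * U t \<bar>y - x\<bar> \<partial>lborel)
    = (\<integral>y. sgn (y - z) * ((y - x) / (\<beta> * t)) * U t \<bar>y - x\<bar> \<partial>lborel)
      - 2 * (a t \<bar>z - x\<bar> * U t \<bar>z - x\<bar>)"
proof -
  define H where "H y = a t \<bar>y - x\<bar> * U t \<bar>y - x\<bar>" for y
  define h where "h y = a_r t \<bar>y - x\<bar> * sgn (y - x) * U t \<bar>y - x\<bar> - (y - x) / (\<beta> * t) * U t \<bar>y - x\<bar>" for y
  define \<Phi> where "\<Phi> y = (if y \<le> z then H z - H y else H y - H z)" for y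
  \<comment> \<open>Both points lie strictly beyond the support and beyond \<open>z\<close>, so
    \<open>H\<close> vanishes there and \<open>\<Phi> d - \<Phi> c\<close> is
    \<open>- 2 * H z\<close>.\<close>
  define c d where "c = min (x - radius t) z - 1" and "d = max (x + radius t) z + 1"
  have contH: "continuous_on A H" for A
    unfolding H_def
    by (rule continuous_on_compose2[OF aU_continuous[OF t]]) (auto intro!: continuous_intros)
  have cont\<Phi>: "continuous_on {c..d} \<Phi>"
  proof -
    have "continuous_on ({c..z} \<union> {z..d}) (\<lambda>y. if y \<le> z then H z - H y else H y - H z)"
      by (intro continuous_on_If continuous_intros contH) auto
    moreover have "{c..z} \<union> {z..d} = {c..d}" by (auto simp: c_def d_def)
    ultimately show ?thesis by (simp add: \<Phi>_def[abs_def])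
  qed
  have dH: "(H has_real_derivative h y) (at y)" if "y \<notin> {x, x - radius t, x + radius t}" for y
    using aU_deriv[OF t, of y x] that unfolding H_def[abs_def] h_def by fastforce
  have d\<Phi>: "(\<Phi> has_real_derivative sgn (y - z) * h y) (at y)"
    if "y \<notin> {z, x, x - radius t, x + radius t}" for y
  proof (cases "y < z")
    case True
    have "((\<lambda>y. H z - H y) has_real_derivative sgn (y - z) * h y) (at y)"
      using dH[of y] that True by (auto intro!: derivative_eq_intros)
    moreover have "eventually (\<lambda>y. \<Phi> y = H z - H y) (nhds y)"
    proof (rule eventually_mono)
      show "eventually (\<lambda>y. y \<in> {..<z}) (nhds y)" using True by (intro eventually_nhds_in_open) auto
    qed (auto simp: \<Phi>_def)
    ultimately show ?thesis by (subst DERIV_cong_ev[OF refl _ refl]) auto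
  next
    case False
    then have "z < y" using that by auto
    have "((\<lambda>y. H y - H z) has_real_derivative sgn (y - z) * h y) (at y)"
      using dH[of y] that \<open>z < y\<close> by (auto intro!: derivative_eq_intros)
    moreover have "eventually (\<lambda>y. \<Phi> y = H y - H z) (nhds y)"
    proof (rule eventually_mono)
      show "eventually (\<lambda>y. y \<in> {z<..}) (nhds y)" using \<open>z < y\<close> by (intro eventually_nhds_in_open) auto
    qed (auto simp: \<Phi>_def)
    ultimately show ?thesis by (subst DERIV_cong_ev[OF refl _ refl]) auto
  qed
  \<comment> \<open>The derivative may fail to exist at four points; continuity of
    \<open>\<Phi>\<close> across them is enough for the fundamental theorem.\<close>
  have "((\<lambda>y. sgn (y - z) * h y) has_integral (\<Phi> d - \<Phi> c)) {c..d}"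
    by (rule fundamental_theorem_of_calculus_interior_strong[of "{z, x, x - radius t, x + radius t}"])
      (use d\<Phi> cont\<Phi> radius_pos[OF t] in
        \<open>auto simp: c_def d_def has_real_derivative_iff_has_vector_derivative\<close>)
  moreover have "h y = 0" if "y \<notin> {c..d}" for y
    using that U_outside[OF t, of "\<bar>y - x\<bar>"] by (auto simp: h_def c_def d_def)
  ultimately have "((\<lambda>y. sgn (y - z) * h y) has_integral (\<Phi> d - \<Phi> c)) UNIV"
    by (rule_tac has_integral_on_superset[of _ _ "{c..d}"]) auto
  moreover have "\<Phi> d - \<Phi> c = - 2 * (a t \<bar>z - x\<bar> * U t \<bar>z - x\<bar>)"
    using U_outside[OF t, of "\<bar>d - x\<bar>"] U_outside[OF t, of "\<bar>c - x\<bar>"]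
    by (auto simp: \<Phi>_def H_def c_def d_def)
  ultimately have total: "((\<lambda>y. sgn (y - z) * h y) has_integral
      (- 2 * (a t \<bar>z - x\<bar> * U t \<bar>z - x\<bar>))) UNIV"
    by simp
  have meas: "(\<lambda>y. sgn (y - z) * sgn (y - x)) \<in> borel_measurable lborel"
    "(\<lambda>y. sgn (y - z)) \<in> borel_measurable lborel"
    by (simp_all)
  have i1: "integrable lborel (\<lambda>y. sgn (y - z) * (a_r t \<bar>y - x\<bar> * sgn (y - x)) * U t \<bar>y - x\<bar>)"
  proof (rule Bochner_Integration.integrable_bound[OF int])
    have "(\<lambda>y. (sgn (y - z) * sgn (y - x)) * (a_r t \<bar>y - x\<bar> * U t \<bar>y - x\<bar>)) \<in> borel_measurable lborel"
      using borel_measurable_times[OF meas(1) borel_measurable_integrable[OF int]] .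
    then show "(\<lambda>y. sgn (y - z) * (a_r t \<bar>y - x\<bar> * sgn (y - x)) * U t \<bar>y - x\<bar>) \<in> borel_measurable lborel"
      by (simp add: ac_simps)
  qed (auto simp: abs_mult sgn_if)
  have int2: "integrable lborel (\<lambda>y. (y - x) / (\<beta> * t) * U t \<bar>y - x\<bar>)"
    by (rule integrable_weighted[OF t]) (use t beta_pos in \<open>auto intro!: continuous_intros\<close>)
  have i2: "integrable lborel (\<lambda>y. sgn (y - z) * ((y - x) / (\<beta> * t)) * U t \<bar>y - x\<bar>)"
  proof (rule Bochner_Integration.integrable_bound[OF int2])
    show "(\<lambda>y. sgn (y - z) * ((y - x) / (\<beta> * t)) * U t \<bar>y - x\<bar>) \<in> borel_measurable lborel"
      using borel_measurable_times[OF meas(2) borel_measurable_integrable[OF int2]]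
      by (simp add: ac_simps)
  qed (auto simp: abs_mult sgn_if)
  have eq: "(\<lambda>y. sgn (y - z) * h y) = (\<lambda>y. sgn (y - z) * (a_r t \<bar>y - x\<bar> * sgn (y - x)) * U t \<bar>y - x\<bar>
      - sgn (y - z) * ((y - x) / (\<beta> * t)) * U t \<bar>y - x\<bar>)"
    by (simp add: h_def fun_eq_iff algebra_simps)
  \<comment> \<open>The fundamental theorem gives a gauge integral. Lebesgue integrability of both
    parts identifies it with the difference of the two Lebesgue integrals.\<close>
  have "integrable lborel (\<lambda>y. sgn (y - z) * h y)"
    unfolding eq by (rule Bochner_Integration.integrable_diff[OF i1 i2])
  from has_integral_integral_lborel[OF this]
  have "((\<lambda>y. sgn (y - z) * h y) has_integral
      ((\<integral>y. sgn (y - z) * (a_r t \<bar>y - x\<bar> * sgn (y - x)) * U t \<bar>y - x\<bar> \<partial>lborel)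
       - (\<integral>y. sgn (y - z) * ((y - x) / (\<beta> * t)) * U t \<bar>y - x\<bar> \<partial>lborel))) UNIV"
    unfolding eq Bochner_Integration.integral_diff[OF i1 i2] .
  from has_integral_unique[OF this total] show ?thesis by linarith
qed

section \<open>Integration in time along self-similar rays\<close>

lemma powr_set_integrable_0:
  fixes b t :: real
  assumes b: "-1 < b" and t: "0 \<le> t"
  shows "set_integrable lborel {0..t} (\<lambda>s. s powr b)"
proof -
  have "(\<lambda>s. s powr b) absolutely_integrable_on {0..t}"
    by (rule nonnegative_absolutely_integrable_1)
      (use has_integral_powr_from_0[OF b t] in \<open>auto simp: integrable_on_def\<close>)
  then show ?thesis
    unfolding set_integrable_def by (subst (asm) integrable_completion) auto
qed

text \<open>The absolute value is differentiated along
  \<open>s \<mapsto> A + s powr (1 / \<beta>) * \<eta>\<close>. The speed is singular at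
  \<open>s = 0\<close> but integrable, since its exponent exceeds -1.\<close>

lemma abs_ftc:
  fixes A \<eta> :: real
  assumes t: "0 \<le> t"
  shows "set_integrable lborel {0..t} (\<lambda>s. sgn (A + s powr (1 / \<beta>) * \<eta>) * (1 / \<beta> * s powr (1 / \<beta> - 1) * \<eta>))"
    and "(LBINT s:{0..t}. sgn (A + s powr (1 / \<beta>) * \<eta>) * (1 / \<beta> * s powr (1 / \<beta> - 1) * \<eta>))
      = \<bar>A + t powr (1 / \<beta>) * \<eta>\<bar> - \<bar>A\<bar>"
proof -
  let ?f = "\<lambda>s. sgn (A + s powr (1 / \<beta>) * \<eta>) * (1 / \<beta> * s powr (1 / \<beta> - 1) * \<eta>)"
  have b: "0 < 1 / \<beta>" using beta_pos by simp
  have "set_integrable lborel {0..t} (\<lambda>s. s powr (1 / \<beta> - 1) * (\<eta> / \<beta>))"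
    using powr_set_integrable_0[of "1 / \<beta> - 1" t] b t by (intro set_integrable_mult_left) auto
  then show int: "set_integrable lborel {0..t} ?f"
    by (rule set_integrable_bound) (auto simp: set_borel_measurable_def abs_mult sgn_if)
  \<comment> \<open>The positive times at which the ray meets the kink of the absolute value: at
    most one, as powers are injective. The case \<open>\<eta> = 0\<close> is excluded because the
    ray is then constant and could stay at the kink.\<close>
  define Z where "Z = {s. 0 < s \<and> \<eta> \<noteq> 0 \<and> A + s powr (1 / \<beta>) * \<eta> = 0}"
  have "Z \<subseteq> {(- A / \<eta>) powr \<beta>}"
  proof
    fix s assume s: "s \<in> Z"
    then have "s powr (1 / \<beta>) = - A / \<eta>" by (auto simp: Z_def field_simps)
    then have "(s powr (1 / \<beta>)) powr \<beta> = (- A / \<eta>) powr \<beta>" by simp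
    then show "s \<in> {(- A / \<eta>) powr \<beta>}" using s beta_pos by (simp add: Z_def powr_powr)
  qed
  then have "finite Z" by (rule finite_subset) simp
  have "(?f has_integral (\<bar>A + t powr (1 / \<beta>) * \<eta>\<bar> - \<bar>A + 0 powr (1 / \<beta>) * \<eta>\<bar>)) {0..t}"
  proof (rule fundamental_theorem_of_calculus_interior_strong[OF \<open>finite Z\<close> t])
    show "continuous_on {0..t} (\<lambda>s. \<bar>A + s powr (1 / \<beta>) * \<eta>\<bar>)"
      using b by (intro continuous_intros continuous_on_powr') auto
    fix s assume s: "s \<in> {0<..<t} - Z"
    then have ne: "0 < s" "\<eta> \<noteq> 0 \<Longrightarrow> A + s powr (1 / \<beta>) * \<eta> \<noteq> 0" by (auto simp: Z_def)
    show "((\<lambda>s. \<bar>A + s powr (1 / \<beta>) * \<eta>\<bar>) has_vector_derivative ?f s) (at s)"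
    proof (cases "\<eta> = 0")
      case False
      have "((\<lambda>s. A + s powr (1 / \<beta>) * \<eta>) has_real_derivative 1 / \<beta> * s powr (1 / \<beta> - 1) * \<eta>) (at s)"
        using ne(1) by (auto intro!: derivative_eq_intros)
      from has_real_derivative_abs[OF this ne(2)[OF False]] show ?thesis
        unfolding has_real_derivative_iff_has_vector_derivative .
    qed simp
  qed
  then have "integral {0..t} ?f = \<bar>A + t powr (1 / \<beta>) * \<eta>\<bar> - \<bar>A\<bar>"
    by (subst integral_unique, assumption) simp
  then show "(LBINT s:{0..t}. ?f s) = \<bar>A + t powr (1 / \<beta>) * \<eta>\<bar> - \<bar>A\<bar>"
    unfolding set_borel_integral_eq_integral(2)[OF int] .
qed

text \<open>Self-similarity: the profile at time \<open>t\<close> is the profile at time 1 dilated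
  by \<open>t powr (1 / \<beta>)\<close>, and the Jacobian of the substitution cancels its
  prefactor.\<close>

lemma integral_scaling:
  fixes g :: "real \<Rightarrow> real"
  assumes t: "0 < t"
  shows "(\<integral>y. g y * U t \<bar>y - x\<bar> \<partial>lborel) = (\<integral>y. g (x + t powr (1 / \<beta>) * y) * U 1 \<bar>y\<bar> \<partial>lborel)"
proof -
  let ?c = "t powr (1 / \<beta>)"
  have c: "0 < ?c" "dil t * ?c = 1" using t by (simp_all add: dil_def powr_minus)
  have U: "?c * U t (?c * \<bar>y\<bar>) = U 1 \<bar>y\<bar>" for y
  proof -
    have "S t (?c * \<bar>y\<bar>) = S 1 \<bar>y\<bar>"
      unfolding S_eq mult.assoc[symmetric] c(2) by (simp add: dil_def)
    then show ?thesis
      unfolding U_eq mult.assoc[symmetric] mult.commute[of ?c] c(2) by (simp add: dil_def)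
  qed
  have "(\<integral>y. g y * U t \<bar>y - x\<bar> \<partial>lborel) = ?c * (\<integral>y. g (x + ?c * y) * U t \<bar>x + ?c * y - x\<bar> \<partial>lborel)"
    using lborel_integral_real_affine[of ?c "\<lambda>y. g y * U t \<bar>y - x\<bar>" x] c by simp
  also have "\<dots> = (\<integral>y. g (x + ?c * y) * (?c * U t (?c * \<bar>y\<bar>)) \<partial>lborel)"
    using c by (simp add: abs_mult ac_simps flip: integral_mult_right_zero)
  finally show ?thesis unfolding U .
qed

text \<open>After rescaling, the density is \<open>U 1\<close> at all times, so the time dependence
  sits only in the argument of the sign and in the speed. Fubini then reduces the claim to
  \<open>abs_ftc\<close> for each fixed \<open>y\<close>.\<close>

lemma temporal_identity:
  fixes x z :: real
  assumes t: "0 < t" and mass: "(\<integral>y. U 1 \<bar>y\<bar> \<partial>lborel) = 1"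
  defines "P \<equiv> \<lambda>s. \<integral>y. sgn (y - z) * ((y - x) / (\<beta> * s)) * U s \<bar>y - x\<bar> \<partial>lborel"
  shows "set_integrable lborel {0..t} P"
    and "(LBINT s:{0..t}. P s) = (\<integral>y. \<bar>y - z\<bar> * U t \<bar>y - x\<bar> \<partial>lborel) - \<bar>x - z\<bar>"
proof -
  let ?k = "\<lambda>s y. sgn (x - z + s powr (1 / \<beta>) * y) * (1 / \<beta> * s powr (1 / \<beta> - 1) * y)"
  let ?f = "\<lambda>s y. indicator {0..t} s * (?k s y * U 1 \<bar>y\<bar>)"
  \<comment> \<open>Majorant of \<open>?f\<close> that splits into a function of \<open>s\<close>
    times a function of \<open>y\<close>.\<close>
  let ?g = "\<lambda>s y. (indicator {0..t} s * s powr (1 / \<beta> - 1)) * (1 / \<beta> * \<bar>y\<bar> * U 1 \<bar>y\<bar>)"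
  have U1: "(\<lambda>y. U 1 \<bar>y\<bar>) \<in> borel_measurable borel"
    using measurable_compose[OF _ measurable_U, of "\<lambda>y::real. (1, \<bar>y\<bar>)"] by simp
  note [measurable] = U1
  have U1_nonneg: "0 \<le> U 1 \<bar>y\<bar>" for y by (simp add: U_eq dil_def)
  have wint: "integrable lborel (\<lambda>y. g y * U 1 \<bar>y\<bar>)" if "continuous_on UNIV g" for g
    using integrable_weighted[OF _ that, of 1 0] by simp
  have sint: "integrable lborel (\<lambda>s. indicator {0..t} s * s powr (1 / \<beta> - 1))"
    using powr_set_integrable_0[of "1 / \<beta> - 1" t] t beta_pos by (simp add: set_integrable_def)
  have yint: "integrable lborel (\<lambda>y. 1 / \<beta> * \<bar>y\<bar> * U 1 \<bar>y\<bar>)"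
    by (rule wint) (intro continuous_intros)
  have gint: "integrable (lborel \<Otimes>\<^sub>M lborel) (\<lambda>(s, y). ?g s y)"
  proof (rule lborel_pair.Fubini_integrable)
    show "(\<lambda>(s, y). ?g s y) \<in> borel_measurable (lborel \<Otimes>\<^sub>M lborel)" by measurable
    have A: "(\<lambda>s. \<integral>y. norm (?g s y) \<partial>lborel)
        = (\<lambda>s. (indicator {0..t} s * s powr (1 / \<beta> - 1)) * (\<integral>y. 1 / \<beta> * \<bar>y\<bar> * U 1 \<bar>y\<bar> \<partial>lborel))"
      using beta_pos U1_nonneg by (simp add: abs_mult)
    show "integrable lborel (\<lambda>s. \<integral>y. norm (case (s, y) of (s, y) \<Rightarrow> ?g s y) \<partial>lborel)"
      unfolding prod.case A using sint by simp
    show "AE s in lborel. integrable lborel (\<lambda>y. case (s, y) of (s, y) \<Rightarrow> ?g s y)"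
      unfolding prod.case by (intro AE_I2 integrable_mult_right yint)
  qed
  have fint: "integrable (lborel \<Otimes>\<^sub>M lborel) (\<lambda>(s, y). ?f s y)"
  proof (rule Bochner_Integration.integrable_bound[OF gint])
    show "(\<lambda>(s, y). ?f s y) \<in> borel_measurable (lborel \<Otimes>\<^sub>M lborel)" by measurable
    show "AE sy in lborel \<Otimes>\<^sub>M lborel. norm (case sy of (s, y) \<Rightarrow> ?f s y) \<le> norm (case sy of (s, y) \<Rightarrow> ?g s y)"
      by (auto simp: abs_mult sgn_if)
  qed
  have P: "(\<integral>y. ?f s y \<partial>lborel) = indicator {0..t} s * P s" for s
  proof (cases "0 < s")
    case True
    have "P s = (\<integral>y. ?k s y * U 1 \<bar>y\<bar> \<partial>lborel)"
      unfolding P_def integral_scaling[OF True]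
    proof (rule Bochner_Integration.integral_cong[OF refl])
      fix y
      have "s powr (1 / \<beta>) = s powr (1 / \<beta> - 1) * s"
        using True by (simp add: powr_diff)
      then show "sgn (x + s powr (1 / \<beta>) * y - z) * ((x + s powr (1 / \<beta>) * y - x) / (\<beta> * s)) * U 1 \<bar>y\<bar>
          = ?k s y * U 1 \<bar>y\<bar>"
        using True beta_pos by (simp add: field_simps)
    qed
    then show ?thesis by simp
  next
    case False
    \<comment> \<open>At \<open>s = 0\<close> both sides vanish by the conventions for division by
      zero and for \<open>0 powr\<close>; negative times are cut off by the indicator.\<close>
    then show ?thesis by (cases "s = 0") (auto simp: P_def)
  qed
  show "set_integrable lborel {0..t} P"
    using lborel_pair.integrable_fst[OF fint, unfolded P] by (simp add: set_integrable_def)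
  have "(LBINT s:{0..t}. P s) = (\<integral>s. \<integral>y. ?f s y \<partial>lborel \<partial>lborel)"
    unfolding P by (simp add: set_lebesgue_integral_def)
  also have "\<dots> = (\<integral>y. \<integral>s. ?f s y \<partial>lborel \<partial>lborel)"
    by (rule lborel_pair.Fubini_integral[OF fint, symmetric])
  also have "\<dots> = (\<integral>y. (\<bar>x + t powr (1 / \<beta>) * y - z\<bar> - \<bar>x - z\<bar>) * U 1 \<bar>y\<bar> \<partial>lborel)"
  proof (rule Bochner_Integration.integral_cong[OF refl])
    fix y
    have "(\<integral>s. ?f s y \<partial>lborel) = (LBINT s:{0..t}. ?k s y) * U 1 \<bar>y\<bar>"
      by (simp add: set_lebesgue_integral_def flip: mult.assoc)
    also have "\<dots> = (\<bar>x - z + t powr (1 / \<beta>) * y\<bar> - \<bar>x - z\<bar>) * U 1 \<bar>y\<bar>"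
      using abs_ftc(2)[of t "x - z" y] t by simp
    finally show "(\<integral>s. ?f s y \<partial>lborel) = (\<bar>x + t powr (1 / \<beta>) * y - z\<bar> - \<bar>x - z\<bar>) * U 1 \<bar>y\<bar>"
      by (simp add: algebra_simps)
  qed
  also have "\<dots> = (\<integral>y. \<bar>x + t powr (1 / \<beta>) * y - z\<bar> * U 1 \<bar>y\<bar> \<partial>lborel) - \<bar>x - z\<bar>"
  proof -
    have "integrable lborel (\<lambda>y. \<bar>x + t powr (1 / \<beta>) * y - z\<bar> * U 1 \<bar>y\<bar>)"
      "integrable lborel (\<lambda>y. \<bar>x - z\<bar> * U 1 \<bar>y\<bar>)"
      by (rule wint, intro continuous_intros)+
    then show ?thesis using mass by (simp add: left_diff_distrib)
  qed
  also have "(\<integral>y. \<bar>x + t powr (1 / \<beta>) * y - z\<bar> * U 1 \<bar>y\<bar> \<partial>lborel) = (\<integral>y. \<bar>y - z\<bar> * U t \<bar>y - x\<bar> \<partial>lborel)"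
    by (rule integral_scaling[OF t, symmetric])
  finally show "(LBINT s:{0..t}. P s) = (\<integral>y. \<bar>y - z\<bar> * U t \<bar>y - x\<bar> \<partial>lborel) - \<bar>x - z\<bar>" .
qed

section \<open>The mean local time of a weak solution\<close>

context
  fixes M :: "'a measure" and F :: "real \<Rightarrow> 'a measure" and x :: real and W X :: "real \<Rightarrow> 'a \<Rightarrow> real"
  assumes sol: "weak_solution p m x M F W X"
begin

interpretation stochastic_basis M F using sol by (simp add: weak_solution_def)

section \<open>Laws, initial value and mean drift of the solution\<close>

lemma law: "0 < s \<Longrightarrow> distributed M lborel (X s) (\<lambda>y. ennreal (U s \<bar>y - x\<bar>))"
  using sol by (simp add: weak_solution_def barenblatt_def)

lemma law_integral:
  assumes "0 < s" "g \<in> borel_measurable borel"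
  shows "expectation (\<lambda>\<omega>. g (X s \<omega>)) = (\<integral>y. g y * U s \<bar>y - x\<bar> \<partial>lborel)"
  using distributed_integral[OF law[OF assms(1)], of g] assms(2) U_nonneg by (simp add: mult.commute)

lemma law_integrable:
  assumes "0 < s" "g \<in> borel_measurable borel"
  shows "integrable M (\<lambda>\<omega>. g (X s \<omega>)) \<longleftrightarrow> integrable lborel (\<lambda>y. g y * U s \<bar>y - x\<bar>)"
  using distributed_integrable[OF law[OF assms(1)], of g] assms(2) U_nonneg by (simp add: mult.commute)

text \<open>The normalisation comes from the fact that \<open>X 1\<close> has total probability one;
  the scaling lemma at \<open>t = 1\<close> moves the centre from \<open>x\<close> to the
  origin.\<close>

lemma mass: "(\<integral>y. U 1 \<bar>y\<bar> \<partial>lborel) = 1"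
  using law_integral[of 1 "\<lambda>_. 1"] integral_scaling[of 1 "\<lambda>_. 1" x] prob_space by simp

lemma X_measurable: "0 \<le> s \<Longrightarrow> X s \<in> borel_measurable M"
  using sol by (auto simp: weak_solution_def adapted_def intro: measurable_F_M)

text \<open>The law of \<open>X s\<close> lives on a ball around \<open>x\<close> whose radius
  shrinks to zero with \<open>s\<close>. Along a sequence of times a single null set suffices, and
  path continuity passes to the limit.\<close>

lemma start: "AE \<omega> in M. X 0 \<omega> = x"
proof -
  let ?s = "\<lambda>n. inverse (real (Suc n))"
  have "AE \<omega> in M. \<bar>X (?s n) \<omega> - x\<bar> \<le> radius (?s n)" for n
  proof (subst distributed_AE2[OF law])
    show "AE y in lborel. 0 < ennreal (U (?s n) \<bar>y - x\<bar>) \<longrightarrow> \<bar>y - x\<bar> \<le> radius (?s n)"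
    proof (intro AE_I2 impI)
      fix y assume "0 < ennreal (U (?s n) \<bar>y - x\<bar>)"
      then show "\<bar>y - x\<bar> \<le> radius (?s n)"
        using U_outside[of "?s n" "\<bar>y - x\<bar>"] by (cases "\<bar>y - x\<bar> \<le> radius (?s n)") auto
    qed
  qed auto
  then have "AE \<omega> in M. \<forall>n. \<bar>X (?s n) \<omega> - x\<bar> \<le> radius (?s n)"
    by (simp add: AE_all_countable)
  then show ?thesis
    using AE_space
  proof eventually_elim
    case (elim \<omega>)
    have "continuous_on {0..} (\<lambda>u. X u \<omega>)"
      using sol elim(2) by (simp add: weak_solution_def continuous_process_def)
    then have "(\<lambda>n. X (?s n) \<omega>) \<longlonglongrightarrow> X 0 \<omega>"
      using LIMSEQ_inverse_real_of_nat
      by - (rule continuous_on_tendsto_compose[of "{0..}" "\<lambda>u. X u \<omega>"], auto)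
    then have "(\<lambda>n. \<bar>X (?s n) \<omega> - x\<bar>) \<longlonglongrightarrow> \<bar>X 0 \<omega> - x\<bar>"
      by (intro tendsto_intros)
    moreover have "(\<lambda>n. radius (?s n)) \<longlonglongrightarrow> bb_rho p m * 0 powr (1 / \<beta>)"
      unfolding radius_def using beta_pos
      by (intro tendsto_intros tendsto_powr' LIMSEQ_inverse_real_of_nat) auto
    ultimately have "\<bar>X 0 \<omega> - x\<bar> \<le> bb_rho p m * 0 powr (1 / \<beta>)"
      using elim(1) by (intro LIMSEQ_le) auto
    then show ?case by simp
  qed
qed

text \<open>Fubini exchanges expectation and time integral, after which the law of
  \<open>X s\<close> replaces the expectation by a spatial integral. The last claim supplies the
  hypothesis of \<open>spatial_identity\<close> at almost every time.\<close>

lemma drift_mean: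
  fixes z :: real
  assumes t: "0 \<le> t"
  defines "D \<equiv> \<lambda>s. \<integral>y. sgn (y - z) * (a_r s \<bar>y - x\<bar> * sgn (y - x)) * U s \<bar>y - x\<bar> \<partial>lborel"
  shows "integrable M (\<lambda>\<omega>. LBINT s:{0..t}. sgn (X s \<omega> - z) * drift p m x X s \<omega>)"
    and "expectation (\<lambda>\<omega>. LBINT s:{0..t}. sgn (X s \<omega> - z) * drift p m x X s \<omega>) = (LBINT s:{0..t}. D s)"
    and "set_integrable lborel {0..t} D"
    and "AE s in lborel. s \<in> {0<..t} \<longrightarrow> integrable lborel (\<lambda>y. a_r s \<bar>y - x\<bar> * U s \<bar>y - x\<bar>)"
proof -
  interpret MP: pair_sigma_finite M lborel ..
  \<comment> \<open>A version of \<open>a_r\<close> that is jointly measurable on the whole plane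
    and agrees with it at nonnegative times.\<close>
  define A where "A = (\<lambda>(s, r). if 0 < s \<and> 0 < r \<and> r < radius s then a_r_explicit s r else 0)"
  have A: "A (s, r) = a_r s r" if "0 \<le> s" for s r
    using that by (simp add: A_def a_r_eq)
  have [measurable]: "A \<in> borel_measurable (borel \<Otimes>\<^sub>M borel)"
    unfolding A_def by (rule measurable_a_r)
  have Am[measurable]: "(\<lambda>y. A (s, \<bar>y - x\<bar>)) \<in> borel_measurable borel" for s by measurable
  define Y where "Y = (\<lambda>(\<omega>, s). X (max 0 s) \<omega>)"
  have [measurable]: "Y \<in> borel_measurable (M \<Otimes>\<^sub>M lborel)"
    using measurable_continuous_process[of X] X_measurable sol
    by (simp add: Y_def weak_solution_def)
  have Y: "Y (\<omega>, s) = X s \<omega>" if "0 \<le> s" for s \<omega> using that by (simp add: Y_def)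
  \<comment> \<open>\<open>G\<close> omits the signs, so it dominates \<open>K\<close> and its
    integral is the quantity bounded for weak solutions.\<close>
  define G where "G = (\<lambda>(\<omega>, s). indicator {0..t} s * A (s, \<bar>Y (\<omega>, s) - x\<bar>))"
  define K where "K = (\<lambda>(\<omega>, s). sgn (Y (\<omega>, s) - z) * (G (\<omega>, s) * sgn (Y (\<omega>, s) - x)))"
  have Gm[measurable]: "G \<in> borel_measurable (M \<Otimes>\<^sub>M lborel)" unfolding G_def by measurable
  have Km[measurable]: "K \<in> borel_measurable (M \<Otimes>\<^sub>M lborel)" unfolding K_def by measurable
  \<comment> \<open>This is where the second integrability condition on weak solutions enters.\<close>
  have G: "integrable (M \<Otimes>\<^sub>M lborel) G"
  proof (rule integrableI_bounded[OF Gm])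
    have "(\<integral>\<^sup>+z. ennreal (norm (G z)) \<partial>(M \<Otimes>\<^sub>M lborel)) = (\<integral>\<^sup>+\<omega>. \<integral>\<^sup>+s. ennreal (norm (G (\<omega>, s))) \<partial>lborel \<partial>M)"
      by (subst lborel.nn_integral_fst[symmetric]) auto
    \<comment> \<open>The bound is available for positive horizons, whereas \<open>t\<close> may be
      zero; hence \<open>t + 1\<close>.\<close>
    also have "\<dots> \<le> (\<integral>\<^sup>+\<omega>. (\<integral>\<^sup>+s\<in>{0..t + 1}. ennreal \<bar>a_r s \<bar>X s \<omega> - x\<bar>\<bar> \<partial>lborel) \<partial>M)"
      by (intro nn_integral_mono) (auto simp: G_def A Y indicator_def)
    also have "\<dots> < \<infinity>" using sol t by (simp add: weak_solution_def)
    finally show "(\<integral>\<^sup>+z. ennreal (norm (G z)) \<partial>(M \<Otimes>\<^sub>M lborel)) < \<infinity>" .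
  qed
  have K: "integrable (M \<Otimes>\<^sub>M lborel) K"
    by (rule Bochner_Integration.integrable_bound[OF G Km]) (auto simp: K_def abs_mult sgn_if)
  have K': "integrable (M \<Otimes>\<^sub>M lborel) (\<lambda>(\<omega>, s). K (\<omega>, s))" using K by simp
  have Kdrift: "(\<integral>s. K (\<omega>, s) \<partial>lborel) = (LBINT s:{0..t}. sgn (X s \<omega> - z) * drift p m x X s \<omega>)" for \<omega>
    unfolding set_lebesgue_integral_def
    by (intro Bochner_Integration.integral_cong) (auto simp: K_def G_def drift_def A Y indicator_def)
  have K0: "expectation (\<lambda>\<omega>. K (\<omega>, s)) = indicator {0..t} s * D s" for s
  proof (cases "s \<in> {0<..t}")
    case True
    then have s: "0 < s" by simp
    have "expectation (\<lambda>\<omega>. K (\<omega>, s)) = expectation (\<lambda>\<omega>. sgn (X s \<omega> - z) * (A (s, \<bar>X s \<omega> - x\<bar>) * sgn (X s \<omega> - x)))"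
      using True by (simp add: K_def G_def Y)
    also have "\<dots> = (\<integral>y. (sgn (y - z) * (A (s, \<bar>y - x\<bar>) * sgn (y - x))) * U s \<bar>y - x\<bar> \<partial>lborel)"
      by (rule law_integral[OF s]) measurable
    finally show ?thesis using True s by (simp add: D_def A)
  next
    case False
    \<comment> \<open>No density is prescribed at time zero, but there the drift coefficient
      vanishes and both sides are zero.\<close>
    then show ?thesis by (cases "s = 0") (auto simp: K_def G_def D_def A_def a_r_eq)
  qed
  show "integrable M (\<lambda>\<omega>. LBINT s:{0..t}. sgn (X s \<omega> - z) * drift p m x X s \<omega>)"
    using MP.integrable_fst[OF K'] by (simp add: Kdrift)
  show "set_integrable lborel {0..t} D"
    using MP.integrable_snd[OF K', unfolded K0] by (simp add: set_integrable_def)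
  show "expectation (\<lambda>\<omega>. LBINT s:{0..t}. sgn (X s \<omega> - z) * drift p m x X s \<omega>) = (LBINT s:{0..t}. D s)"
    using MP.Fubini_integral[OF K', unfolded K0 Kdrift] by (simp add: set_lebesgue_integral_def)
  have "AE s in lborel. integrable M (\<lambda>\<omega>. G (\<omega>, s))"
    using MP.AE_integrable_snd[of "\<lambda>\<omega> s. G (\<omega>, s)"] G by simp
  then show "AE s in lborel. s \<in> {0<..t} \<longrightarrow> integrable lborel (\<lambda>y. a_r s \<bar>y - x\<bar> * U s \<bar>y - x\<bar>)"
  proof eventually_elim
    case (elim s)
    show ?case
    proof
      assume s: "s \<in> {0<..t}"
      then have "integrable M (\<lambda>\<omega>. A (s, \<bar>X s \<omega> - x\<bar>))"
        using elim by (simp add: G_def Y)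
      then show "integrable lborel (\<lambda>y. a_r s \<bar>y - x\<bar> * U s \<bar>y - x\<bar>)"
        using law_integrable[OF _ Am[of s], of s] s by (simp add: A)
    qed
  qed
qed

section \<open>Assembling the mean of the local time\<close>

lemma abs_mean:
  fixes z :: real
  assumes t: "0 \<le> t"
  defines "P \<equiv> \<lambda>s. \<integral>y. sgn (y - z) * ((y - x) / (\<beta> * s)) * U s \<bar>y - x\<bar> \<partial>lborel"
  shows "integrable M (\<lambda>\<omega>. \<bar>X t \<omega> - z\<bar>)" and "set_integrable lborel {0..t} P"
    and "expectation (\<lambda>\<omega>. \<bar>X t \<omega> - z\<bar>) = \<bar>x - z\<bar> + (LBINT s:{0..t}. P s)"
proof -
  have "integrable M (\<lambda>\<omega>. \<bar>X t \<omega> - z\<bar>) \<and> set_integrable lborel {0..t} P \<and>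
    expectation (\<lambda>\<omega>. \<bar>X t \<omega> - z\<bar>) = \<bar>x - z\<bar> + (LBINT s:{0..t}. P s)"
  proof (cases "t = 0")
    case False
    then have t: "0 < t" using t by simp
    have "integrable M (\<lambda>\<omega>. \<bar>X t \<omega> - z\<bar>)"
      using law_integrable[OF t, of "\<lambda>y. \<bar>y - z\<bar>"] integrable_weighted[OF t, of "\<lambda>y. \<bar>y - z\<bar>" x]
      by (simp add: continuous_intros)
    then show ?thesis
      using temporal_identity[OF t mass, where x = x and z = z] law_integral[OF t, of "\<lambda>y. \<bar>y - z\<bar>"]
      by (simp add: P_def)
  next
    \<comment> \<open>At time zero \<open>start\<close> replaces the missing density, and the
      integral over a single point vanishes because \<open>P 0 = 0\<close> by division by
      zero.\<close>
    case True
    have "AE \<omega> in M. \<bar>X t \<omega> - z\<bar> = \<bar>x - z\<bar>" using start True by auto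
    moreover have "(\<lambda>\<omega>. \<bar>X t \<omega> - z\<bar>) \<in> borel_measurable M"
      using X_measurable[OF t] by measurable
    ultimately have "integrable M (\<lambda>\<omega>. \<bar>X t \<omega> - z\<bar>)" "expectation (\<lambda>\<omega>. \<bar>X t \<omega> - z\<bar>) = \<bar>x - z\<bar>"
      using integrable_cong_AE[of "\<lambda>\<omega>. \<bar>X t \<omega> - z\<bar>" M "\<lambda>_. \<bar>x - z\<bar>"]
        integral_cong_AE[of "\<lambda>\<omega>. \<bar>X t \<omega> - z\<bar>" M "\<lambda>_. \<bar>x - z\<bar>"] by (auto simp: prob_space)
    moreover have "(\<lambda>s. indicator {0..t} s * P s) = (\<lambda>s. 0)"
      using True by (auto simp: P_def indicator_def fun_eq_iff)
    ultimately show ?thesis by (simp add: set_integrable_def set_lebesgue_integral_def)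
  qed
  then show "integrable M (\<lambda>\<omega>. \<bar>X t \<omega> - z\<bar>)" "set_integrable lborel {0..t} P"
    "expectation (\<lambda>\<omega>. \<bar>X t \<omega> - z\<bar>) = \<bar>x - z\<bar> + (LBINT s:{0..t}. P s)" by auto
qed

text \<open>The mean of \<open>L t\<close> is the time integral of \<open>P - D\<close>, where
  \<open>P\<close> comes from the spreading of the law and \<open>D\<close> from the drift;
  \<open>spatial_identity\<close> evaluates this difference at almost every time.\<close>

lemma nn_mean_local_time:
  fixes z :: real
  assumes L: "local_time M F W (diffusion p m x X) (drift p m x X) X z L" and t: "0 \<le> t"
  shows "(\<integral>\<^sup>+\<omega>. ennreal (L t \<omega>) \<partial>M)
    = (\<integral>\<^sup>+s\<in>{0..t}. ennreal (2 * (a s \<bar>z - x\<bar> * U s \<bar>z - x\<bar>)) \<partial>lborel)"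
proof -
  define P where "P s = (\<integral>y. sgn (y - z) * ((y - x) / (\<beta> * s)) * U s \<bar>y - x\<bar> \<partial>lborel)" for s
  define D where "D s = (\<integral>y. sgn (y - z) * (a_r s \<bar>y - x\<bar> * sgn (y - x)) * U s \<bar>y - x\<bar> \<partial>lborel)" for s
  define Q where "Q s = 2 * (a s \<bar>z - x\<bar> * U s \<bar>z - x\<bar>)" for s
  have bm: "brownian_motion M F W" using sol by (simp add: weak_solution_def)
  note mt = abs_mean[OF t, of z, folded P_def] and m0 = abs_mean[OF order_refl, of z, folded P_def]
    and dm = drift_mean(1-3)[OF t, of z, folded D_def]
  note Lm = local_time_mean[OF bm L t mt(1) m0(1) dm(1)]
  have PD: "set_integrable lborel {0..t} (\<lambda>s. P s - D s)"
    by (rule set_integral_diff(1)[OF mt(2) dm(3)])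
  have m00: "expectation (\<lambda>\<omega>. \<bar>X 0 \<omega> - z\<bar>) = \<bar>x - z\<bar>"
  proof -
    have "(\<lambda>s. indicator {0..0} s *\<^sub>R P s) = (\<lambda>_. 0)"
      by (auto simp: fun_eq_iff indicator_def P_def)
    then show ?thesis unfolding m0(3) by (simp add: set_lebesgue_integral_def)
  qed
  have "expectation (L t) = (LBINT s:{0..t}. P s) - (LBINT s:{0..t}. D s)"
    using Lm(2) mt(3) m00 dm(2) by simp
  also have "\<dots> = (LBINT s:{0..t}. P s - D s)"
    using set_integral_diff(2)[OF mt(2) dm(3)] by simp
  finally have EL: "expectation (L t) = (LBINT s:{0..t}. P s - D s)" .
  \<comment> \<open>The exceptional times are \<open>s = 0\<close> and those at which spatial
    integrability of the drift fails.\<close>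
  have eq: "AE s in lborel. indicator {0..t} s *\<^sub>R (P s - D s) = indicator {0..t} s * Q s"
    using drift_mean(4)[OF t] AE_lborel_singleton[of 0]
  proof eventually_elim
    case (elim s)
    then show ?case
      using spatial_identity[of s x z] by (auto simp: P_def D_def Q_def indicator_def)
  qed
  have Qm: "(\<lambda>s. indicator {0..t} s * Q s) \<in> borel_measurable lborel"
    using borel_measurable_times[OF borel_measurable_const[of 2] measurable_aU[of t "\<bar>z - x\<bar>"]]
    by (simp add: Q_def ac_simps)
  have PDm: "(\<lambda>s. indicator {0..t} s *\<^sub>R (P s - D s)) \<in> borel_measurable lborel"
    using PD by (auto simp: set_integrable_def)
  have Qi: "integrable lborel (\<lambda>s. indicator {0..t} s * Q s)"
    using integrable_cong_AE[OF PDm Qm eq] PD by (simp add: set_integrable_def)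
  have "expectation (L t) = (\<integral>s. indicator {0..t} s * Q s \<partial>lborel)"
    using integral_cong_AE[OF PDm Qm eq] EL by (simp add: set_lebesgue_integral_def)
  moreover have "(\<integral>\<^sup>+\<omega>. ennreal (L t \<omega>) \<partial>M) = ennreal (expectation (L t))"
    using L t by (intro nn_integral_eq_integral Lm(1)) (auto simp: local_time_def)
  moreover have "(\<integral>\<^sup>+s. ennreal (indicator {0..t} s * Q s) \<partial>lborel) = ennreal (\<integral>s. indicator {0..t} s * Q s \<partial>lborel)"
    using aU_nonneg by (intro nn_integral_eq_integral Qi) (auto simp: Q_def indicator_def)
  moreover have "(\<integral>\<^sup>+s. ennreal (indicator {0..t} s * Q s) \<partial>lborel) = (\<integral>\<^sup>+s\<in>{0..t}. ennreal (Q s) \<partial>lborel)"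
    by (intro nn_integral_cong) (auto simp: indicator_def)
  ultimately show ?thesis by (simp add: Q_def)
qed

end
end

theorem theorem1p3:
  fixes p m x z t :: real
    and M :: "'a measure" and F :: "real \<Rightarrow> 'a measure"
    and W X :: "real \<Rightarrow> 'a \<Rightarrow> real" and L :: "real \<Rightarrow> real \<Rightarrow> 'a \<Rightarrow> real"
  assumes "1 < p" and "0 < m" and "1 < m * (p - 1)" and "2 < p"
    and "weak_solution p m x M F W X"
    and "continuous_local_time M F W (diffusion p m x X) (drift p m x X) X L"
    and "0 \<le> t"
  shows "(\<integral>\<^sup>+\<omega>. ennreal (L z t \<omega>) \<partial>M) =
    (if x \<noteq> z
     then ennreal (2 * m powr (p - 1)) *
       (\<integral>\<^sup>+s\<in>{0..t}.
          (if bb_rho p m * s powr (1 / bb_beta p m) \<le> \<bar>z - x\<bar> then 0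
           else ennreal (\<bar>deriv (barenblatt p m x s) z\<bar> powr (p - 2)
                  * barenblatt p m x s z powr ((m - 1) * (p - 1) + 1))) \<partial>lborel)
     else 0)"
proof -
  note sol = assms(5)
  interpret stochastic_basis M F using sol by (simp add: weak_solution_def)
  have "distributed M lborel (X 1) (\<lambda>y. ennreal (barenblatt p m x 1 y))"
    using sol by (simp add: weak_solution_def)
  from bb_C_pos_if_density[OF assms(4,2,3) this]
  interpret barenblatt_params p m using assms by unfold_locales auto
  let ?g = "\<lambda>s. if bb_rho p m * s powr (1 / bb_beta p m) \<le> \<bar>z - x\<bar> then 0
           else ennreal (\<bar>deriv (barenblatt p m x s) z\<bar> powr (p - 2)
                  * barenblatt p m x s z powr ((m - 1) * (p - 1) + 1))"
  let ?h = "\<lambda>s. a s \<bar>z - x\<bar> * U s \<bar>z - x\<bar>"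
  have "local_time M F W (diffusion p m x X) (drift p m x X) X z (L z)"
    using assms(6) by (simp add: continuous_local_time_def)
  from nn_mean_local_time[OF sol this assms(7)]
  have main: "(\<integral>\<^sup>+\<omega>. ennreal (L z t \<omega>) \<partial>M) = (\<integral>\<^sup>+s\<in>{0..t}. ennreal (2 * ?h s) \<partial>lborel)" .
  show ?thesis
  proof (cases "x = z")
    case True
    \<comment> \<open>The coefficient is zero at \<open>r = 0\<close>, so the integrand in
      \<open>main\<close> vanishes at every time.\<close>
    then show ?thesis unfolding main by (simp add: coeff_a_def)
  next
    case False
    have g: "?g s = ennreal (?h s / m powr (p - 1))" if "0 \<le> s" for s
    proof (cases "radius s \<le> \<bar>z - x\<bar>")
      case True
      then show ?thesis by (simp add: coeff_a_def radius_def)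
    next
      case inside: False
      \<comment> \<open>At \<open>s = 0\<close> the radius is zero, so no point can lie inside the
        support.\<close>
      then have s: "0 < s" using that by (cases "s = 0") (auto simp: radius_def)
      then show ?thesis
        using inside False aU_inside[of s "\<bar>z - x\<bar>"] deriv_barenblatt[of s z x] m
        by (simp add: barenblatt_def flip: radius_def)
    qed
    have "(\<integral>\<^sup>+s\<in>{0..t}. ?g s \<partial>lborel) = (\<integral>\<^sup>+s. ennreal (indicator {0..t} s * ?h s / m powr (p - 1)) \<partial>lborel)"
    proof (intro nn_integral_cong)
      fix s
      show "?g s * indicator {0..t} s = ennreal (indicator {0..t} s * ?h s / m powr (p - 1))"
        using g[of s] by (cases "s \<in> {0..t}") simp_all
    qed
    then have "ennreal (2 * m powr (p - 1)) * (\<integral>\<^sup>+s\<in>{0..t}. ?g s \<partial>lborel)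
        = (\<integral>\<^sup>+s. ennreal (2 * m powr (p - 1)) * ennreal (indicator {0..t} s * ?h s / m powr (p - 1)) \<partial>lborel)"
      using measurable_aU[of t "\<bar>z - x\<bar>"] by (simp add: nn_integral_cmult)
    \<comment> \<open>Since \<open>m\<close> is positive, the factor \<open>m powr (p - 1)\<close>
      contained in \<open>a\<close> cancels against the constant in front.\<close>
    also have "\<dots> = (\<integral>\<^sup>+s\<in>{0..t}. ennreal (2 * ?h s) \<partial>lborel)"
      using m by (intro nn_integral_cong) (auto simp: indicator_def simp flip: ennreal_mult')
    finally show ?thesis using False main by simp
  qed
qed

end
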